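(* For every integer $k\ge1$, $$\sup\Big\{\Big(\int_{\mathbb{R}}\rho\,dx\Big)^{2}\mu_k(\rho)\;:\;\rho:\mathbb{R}\to[0,1]\text{ measurable},\ 0<\int_{\mathbb{R}}\rho\,dx<+\infty\Big\}=\pi^2k^2 .$$ Moreover, the supremum is attained (that is, $\big(\int_{\mathbb{R}}\rho\,dx\big)^2\mu_k(\rho)=\pi^2k^2$) whenever $\rho$ is the characteristic function of a union of at most $k$ open, pairwise disjoint segments of total length $m:=\int_{\mathbb{R}}\rho\,dx>0$, each of which has length an integer multiple of $\frac{m}{k}$.
   Context: For a measurable $\rho:\mathbb{R}\to[0,1]$ with $0<\int_{\mathbb{R}}\rho\,dx<+\infty$ and an integer $k\ge 0$, $$\mu_k(\rho):=\inf_{S\in\mathcal{S}_{k+1}}\ \max_{u\in S\setminus\{0\}}\frac{\int_{\mathbb{R}}\rho\,(u')^2dx}{\int_{\mathbb{R}}\rho u^2dx},$$ where $\mathcal{S}_{k+1}$ is the family of all linear subspaces of dimension $k+1$ of $\{u\cdot 1_{\{\rho>0\}}:u\in C_c^\infty(\mathbb{R})\}$ (functions identified when equal almost everywhere; $u'$ is the derivative of the smooth function $u$, which on $\{\rho>0\}$ depends only on $u\cdot 1_{\{\rho>0\}}$ up to null sets). *)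

theory Defs
  imports "HOL-Analysis.Analysis"
begin

definition ae_eq :: "(real \<Rightarrow> real) \<Rightarrow> (real \<Rightarrow> real) \<Rightarrow> bool"
  where "ae_eq f g \<longleftrightarrow> (AE x in lebesgue. f x = g x)"

lemma equivp_ae_eq: "equivp ae_eq"
proof (rule equivpI)
  show "reflp ae_eq" by (auto simp: reflp_def ae_eq_def)
  show "symp ae_eq" by (auto simp: symp_def ae_eq_def eq_commute)
  show "transp ae_eq"
    unfolding transp_def ae_eq_def
  proof (intro allI impI)
    fix f g h :: "real \<Rightarrow> real"
    assume "AE x in lebesgue. f x = g x" "AE x in lebesgue. g x = h x"
    then show "AE x in lebesgue. f x = h x" by eventually_elim simp
  qed
qed

text \<open>The real vector space of real functions on the line, identified when equal almost
  everywhere. Measurability is not imposed here; it is automatic for the elements of the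
  subspace \<open>trial_space\<close> below.\<close>

quotient_type ae_fun = "real \<Rightarrow> real" / ae_eq
  by (rule equivp_ae_eq)

instantiation ae_fun :: real_vector
begin

lift_definition zero_ae_fun :: ae_fun is "\<lambda>_. 0" .

lift_definition plus_ae_fun :: "ae_fun \<Rightarrow> ae_fun \<Rightarrow> ae_fun" is "\<lambda>f g x. f x + g x"
  unfolding ae_eq_def
proof -
  fix f f' g g' :: "real \<Rightarrow> real"
  assume "AE x in lebesgue. f x = f' x" "AE x in lebesgue. g x = g' x"
  then show "AE x in lebesgue. f x + g x = f' x + g' x" by eventually_elim simp
qed

lift_definition minus_ae_fun :: "ae_fun \<Rightarrow> ae_fun \<Rightarrow> ae_fun" is "\<lambda>f g x. f x - g x"
  unfolding ae_eq_def
proof -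
  fix f f' g g' :: "real \<Rightarrow> real"
  assume "AE x in lebesgue. f x = f' x" "AE x in lebesgue. g x = g' x"
  then show "AE x in lebesgue. f x - g x = f' x - g' x" by eventually_elim simp
qed

lift_definition uminus_ae_fun :: "ae_fun \<Rightarrow> ae_fun" is "\<lambda>f x. - f x"
  unfolding ae_eq_def by auto

lift_definition scaleR_ae_fun :: "real \<Rightarrow> ae_fun \<Rightarrow> ae_fun" is "\<lambda>c f x. c * f x"
  unfolding ae_eq_def by auto

instance
  by standard (transfer; auto simp: ae_eq_def algebra_simps)+

end

definition densities :: "(real \<Rightarrow> real) set"
  where "densities = {\<rho>. \<rho> \<in> borel_measurable lebesgue \<and> (\<forall>x. 0 \<le> \<rho> x \<and> \<rho> x \<le> 1) \<and>
     integrable lebesgue \<rho> \<and> 0 < integral\<^sup>L lebesgue \<rho>}"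

definition test_functions :: "(real \<Rightarrow> real) set"
  where "test_functions = {u. (\<forall>n x. (deriv ^^ n) u field_differentiable at x) \<and>
     compact (closure {x. u x \<noteq> 0})}"

definition restr :: "(real \<Rightarrow> real) \<Rightarrow> (real \<Rightarrow> real) \<Rightarrow> ae_fun"
  where "restr \<rho> u = abs_ae_fun (\<lambda>x. u x * indicator {y. 0 < \<rho> y} x)"

definition trial_space :: "(real \<Rightarrow> real) \<Rightarrow> ae_fun set"
  where "trial_space \<rho> = restr \<rho> ` test_functions"

text \<open>A subspace of infinite dimension has \<open>dim\<close> equal to 0, so that \<open>dim S = d\<close> with
  \<open>d > 0\<close> entails finite dimension.\<close>

definition trial_subspaces :: "nat \<Rightarrow> (real \<Rightarrow> real) \<Rightarrow> ae_fun set set"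
  where "trial_subspaces d \<rho> = {S. subspace S \<and> S \<subseteq> trial_space \<rho> \<and> dim S = d}"

definition rayleigh :: "(real \<Rightarrow> real) \<Rightarrow> (real \<Rightarrow> real) \<Rightarrow> real"
  where "rayleigh \<rho> u = (\<integral>x. \<rho> x * (deriv u x)\<^sup>2 \<partial>lebesgue) / (\<integral>x. \<rho> x * (u x)\<^sup>2 \<partial>lebesgue)"

text \<open>The quotient depends on \<open>u\<close> only through its class \<open>restr \<rho> u\<close>: at a zero of a
  differentiable function where the derivative does not vanish, the zero is isolated, and a set
  of isolated points is countable.\<close>

lemma countable_simple_zeros:
  fixes w w' :: "real \<Rightarrow> real"
  assumes "\<And>x. (w has_real_derivative w' x) (at x)"
  shows "countable {x. w x = 0 \<and> w' x \<noteq> 0}"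
proof -
  define Z where "Z = {x. w x = 0 \<and> w' x \<noteq> 0}"
  obtain B :: "real set set" where B: "countable B" "topological_basis B"
    using ex_countable_basis by blast
  have "\<exists>U\<in>B. z \<in> U \<and> U \<inter> Z = {z}" if z: "z \<in> Z" for z
  proof -
    have "((\<lambda>x. (w x - w z) / (x - z)) \<longlongrightarrow> w' z) (at z)"
      using assms[of z] by (simp add: has_field_derivative_iff)
    then have "\<forall>\<^sub>F x in at z. (w x - w z) / (x - z) \<noteq> 0"
      by (rule tendsto_imp_eventually_ne) (use z in \<open>auto simp: Z_def\<close>)
    then obtain V where V: "open V" "z \<in> V" "\<And>x. x \<in> V \<Longrightarrow> x \<noteq> z \<Longrightarrow> w x \<noteq> w z"
      unfolding eventually_at_topological by auto
    obtain U where "U \<in> B" "z \<in> U" "U \<subseteq> V"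
      using topological_basisE[OF B(2) V(1,2)] by blast
    moreover have "V \<inter> Z \<subseteq> {z}" using V(3) z by (force simp: Z_def)
    ultimately show ?thesis using z by blast
  qed
  then obtain U where U: "\<And>z. z \<in> Z \<Longrightarrow> U z \<in> B \<and> z \<in> U z \<and> U z \<inter> Z = {z}" by metis
  have "inj_on U Z" by (rule inj_onI) (metis U singleton_inject)
  moreover have "countable (U ` Z)" by (rule countable_subset[OF _ B(1)]) (use U in auto)
  ultimately have "countable Z" by (simp add: countable_image_inj_eq)
  then show ?thesis by (simp add: Z_def)
qed

lemma rayleigh_cong:
  assumes \<rho>: "\<rho> \<in> densities" and u: "u \<in> test_functions" and v: "v \<in> test_functions"
    and eq: "restr \<rho> u = restr \<rho> v"
  shows "rayleigh \<rho> u = rayleigh \<rho> v"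
proof -
  have test_deriv: "(f has_real_derivative deriv f x) (at x)" if "f \<in> test_functions" for f x
  proof -
    have "(deriv ^^ 0) f field_differentiable at x"
      using that unfolding test_functions_def by blast
    then show ?thesis by (simp add: DERIV_deriv_iff_field_differentiable)
  qed
  have ae: "AE x in lebesgue. u x * indicator {y. 0 < \<rho> y} x = v x * indicator {y. 0 < \<rho> y} x"
    using eq by (simp add: restr_def ae_fun.abs_eq_iff ae_eq_def)
  have "((\<lambda>x. u x - v x) has_real_derivative deriv u x - deriv v x) (at x)" for x
    by (intro derivative_intros test_deriv u v)
  then have "countable {x. u x - v x = 0 \<and> deriv u x - deriv v x \<noteq> 0}"
    by (rule countable_simple_zeros)
  then have "{x. u x - v x = 0 \<and> deriv u x - deriv v x \<noteq> 0} \<in> null_sets lebesgue"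
    by (intro null_sets_completionI countable_imp_null_set_lborel)
  then have "AE x in lebesgue. \<not> (u x - v x = 0 \<and> deriv u x - deriv v x \<noteq> 0)"
    by (drule_tac AE_not_in) simp
  with ae have both: "AE x in lebesgue. 0 < \<rho> x \<longrightarrow> u x = v x \<and> deriv u x = deriv v x"
    by eventually_elim (auto simp: indicator_def)
  have nonneg: "0 \<le> \<rho> x" for x using \<rho> by (simp add: densities_def)
  have meas [measurable]: "\<rho> \<in> borel_measurable lebesgue" using \<rho> by (simp add: densities_def)
  have test_meas: "f \<in> borel_measurable lebesgue" "deriv f \<in> borel_measurable lebesgue"
    if f: "f \<in> test_functions" for f
  proof -
    have "(deriv ^^ n) f field_differentiable at x" for n x
      using f unfolding test_functions_def by blast
    then have "continuous_on UNIV ((deriv ^^ n) f)" for n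
      by (simp add: continuous_on_eq_continuous_at field_differentiable_imp_continuous_at)
    from this[of 0] this[of 1]
    show "f \<in> borel_measurable lebesgue" "deriv f \<in> borel_measurable lebesgue"
      by (simp_all add: borel_measurable_continuous_onI measurable_completion)
  qed
  note [measurable] = test_meas[OF u] test_meas[OF v]
  have "(\<integral>x. \<rho> x * (deriv u x)\<^sup>2 \<partial>lebesgue) = (\<integral>x. \<rho> x * (deriv v x)\<^sup>2 \<partial>lebesgue)"
  proof (rule integral_cong_AE)
    from both show "AE x in lebesgue. \<rho> x * (deriv u x)\<^sup>2 = \<rho> x * (deriv v x)\<^sup>2"
      by eventually_elim (use nonneg in \<open>auto simp: less_le\<close>)
  qed measurable
  moreover have "(\<integral>x. \<rho> x * (u x)\<^sup>2 \<partial>lebesgue) = (\<integral>x. \<rho> x * (v x)\<^sup>2 \<partial>lebesgue)"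
  proof (rule integral_cong_AE)
    from both show "AE x in lebesgue. \<rho> x * (u x)\<^sup>2 = \<rho> x * (v x)\<^sup>2"
      by eventually_elim (use nonneg in \<open>auto simp: less_le\<close>)
  qed measurable
  ultimately show ?thesis by (simp add: rayleigh_def)
qed

text \<open>The maximum over \<open>S - {0}\<close> is taken over all smooth functions whose class is a nonzero
  element of \<open>S\<close>. It is written as a supremum in the extended reals; since \<open>S\<close> is
  finite-dimensional and both integrals are quadratic forms on it, the second one positive
  definite, it is attained when \<open>\<rho> \<in> densities\<close> and \<open>S \<noteq> {0}\<close>.\<close>

definition mu :: "nat \<Rightarrow> (real \<Rightarrow> real) \<Rightarrow> ereal"
  where "mu k \<rho> = (INF S\<in>trial_subspaces (k + 1) \<rho>.
     SUP u\<in>{u \<in> test_functions. restr \<rho> u \<in> S - {0}}. ereal (rayleigh \<rho> u))"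

end

theory Submission
  imports Defs
begin

text \<open>Upper bound: let \<open>F\<close> be the primitive of \<open>\<rho>\<close>, a 1-Lipschitz map carrying \<open>\<rho> dx\<close> to Lebesgue
  measure on \<open>[0, m]\<close>. For \<open>u = f \<circ> F\<close> we have \<open>\<integral>\<rho> u\<^sup>2 = \<integral>\<^sub>0\<^sup>m f\<^sup>2\<close> and
  \<open>\<integral>\<rho> (u')\<^sup>2 = \<integral>\<rho>\<^sup>3 f'(F)\<^sup>2 \<le> \<integral>\<^sub>0\<^sup>m (f')\<^sup>2\<close>, so the Neumann eigenfunctions \<open>f = cos (\<pi> i t / m)\<close>, \<open>i \<le> k\<close>, of
  \<open>[0, m]\<close> give the bound, up to an approximation by compactly supported smooth functions.

  Lower bound for the extremal \<open>\<rho>\<close>: the segments split into \<open>k\<close> pieces of length \<open>m / k\<close>. Any trial space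
  of dimension \<open>k + 1\<close> contains a nonzero function with zero mean on every piece, and the sharp
  Poincare-Wirtinger inequality on the pieces bounds its Rayleigh quotient from below by \<open>(\<pi> k / m)\<^sup>2\<close>.\<close>

section \<open>Smooth functions\<close>

text \<open>The formula for \<open>(f \<circ> F)'\<close> only serves as a guide. \<open>F\<close>
  is merely Lipschitz, so \<open>f \<circ> F\<close> is no trial function, and no almost-everywhere
  derivative of \<open>F\<close> is ever taken. What the estimate really exploits is that slopes of
  \<open>F\<close> are at most 1, and smooth substitutes for \<open>F\<close> inherit this up to a
  small error. As \<rho> dx is a finite measure, uniformly bounded integrands pass to the limit. The
  second obstacle is uniformity: the infimum asks for a space of dimension exactly k + 1 whose
  quotients are bounded for all coefficient vectors at once. Both demands are read as positive
  definiteness of matrices of size k + 1 with diagonal limits. A slack \<epsilon> in the constant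
  keeps those limits positive; it is removed at the end. The two bounds meet because the k-th
  Neumann eigenvalue of an interval of length m is the first nonzero one of an interval of length m
  / k.\<close>

definition smooth :: "(real \<Rightarrow> real) \<Rightarrow> bool"
  where "smooth f \<longleftrightarrow> (\<forall>n x. (deriv ^^ n) f field_differentiable at x)"

text \<open>Derivatives are unique, so \<open>deriv\<close> maps a family closed under
  differentiation into itself, and all iterated derivatives stay in it. Smoothness thus reduces to
  naming such a family, with no formula for n-th derivatives.\<close>

lemma smooth_coinduct:
  assumes "f \<in> C"
    and step: "\<And>f. f \<in> C \<Longrightarrow> \<exists>f'\<in>C. \<forall>x. (f has_real_derivative f' x) (at x)"
  shows "smooth f"
proof -
  have deriv_C: "deriv g \<in> C" if g: "g \<in> C" for g
  proof -
    obtain g' where g': "g' \<in> C" "\<forall>x. (g has_real_derivative g' x) (at x)"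
      using step[OF g] by blast
    then have "deriv g = g'" by (intro ext DERIV_imp_deriv) blast
    with g' show ?thesis by simp
  qed
  have "(deriv ^^ n) f \<in> C" for n
    by (induction n) (simp_all add: \<open>f \<in> C\<close> deriv_C)
  then show ?thesis
    unfolding smooth_def field_differentiable_def using step by blast
qed

lemma smooth_deriv:
  assumes "smooth f"
  shows "smooth (deriv f)"
proof -
  have "(deriv ^^ n) (deriv f) = (deriv ^^ Suc n) f" for n
    by (simp only: funpow_Suc_right comp_apply)
  then show ?thesis using assms unfolding smooth_def by metis
qed

lemma smooth_DERIV:
  assumes "smooth f"
  shows "(f has_real_derivative deriv f x) (at x)"
proof -
  have "(deriv ^^ 0) f field_differentiable at x"
    using assms unfolding smooth_def by blast
  then show ?thesis by (simp add: DERIV_deriv_iff_field_differentiable)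
qed

lemma smooth_continuous_on: "smooth f \<Longrightarrow> continuous_on A f"
  by (meson smooth_DERIV DERIV_isCont continuous_at_imp_continuous_on)

lemma continuous_measurable_lebesgue:
  "continuous_on UNIV f \<Longrightarrow> (f :: real \<Rightarrow> real) \<in> borel_measurable lebesgue"
  by (simp add: measurable_completion borel_measurable_continuous_onI)

lemma smooth_measurable: "smooth f \<Longrightarrow> f \<in> borel_measurable lebesgue"
  by (intro continuous_measurable_lebesgue smooth_continuous_on)

text \<open>The derivative of an expression built from smooth functions is again such an expression,
  so this set serves as invariant in the coinduction.\<close>

inductive smooth_expr :: "(real \<Rightarrow> real) \<Rightarrow> bool" where
  base: "smooth f \<Longrightarrow> smooth_expr f"
| add: "smooth_expr f \<Longrightarrow> smooth_expr g \<Longrightarrow> smooth_expr (\<lambda>x. f x + g x)"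
| mult: "smooth_expr f \<Longrightarrow> smooth_expr g \<Longrightarrow> smooth_expr (\<lambda>x. f x * g x)"
| comp: "smooth_expr f \<Longrightarrow> smooth_expr g \<Longrightarrow> smooth_expr (\<lambda>x. f (g x))"

lemma smooth_expr_derivative:
  assumes "smooth_expr f"
  shows "\<exists>f'. smooth_expr f' \<and> (\<forall>x. (f has_real_derivative f' x) (at x))"
  using assms
proof induction
  case (base f)
  then show ?case using smooth_DERIV smooth_deriv smooth_expr.base by blast
next
  case (add f g)
  then obtain f' g' where "smooth_expr f'" "smooth_expr g'"
    "\<forall>x. (f has_real_derivative f' x) (at x)" "\<forall>x. (g has_real_derivative g' x) (at x)" by blast
  then show ?case
    by (intro exI[of _ "\<lambda>x. f' x + g' x"] conjI smooth_expr.add allI DERIV_add) blast+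
next
  case (mult f g)
  then obtain f' g' where "smooth_expr f'" "smooth_expr g'"
    "\<forall>x. (f has_real_derivative f' x) (at x)" "\<forall>x. (g has_real_derivative g' x) (at x)" by blast
  with mult.hyps show ?case
    by (intro exI[of _ "\<lambda>x. f' x * g x + g' x * f x"] conjI allI DERIV_mult
          smooth_expr.add[of "\<lambda>x. f' x * g x" "\<lambda>x. g' x * f x"] smooth_expr.mult) blast+
next
  case (comp f g)
  then obtain f' g' where "smooth_expr f'" "smooth_expr g'"
    "\<forall>x. (f has_real_derivative f' x) (at x)" "\<forall>x. (g has_real_derivative g' x) (at x)" by blast
  with comp.hyps show ?case
    by (intro exI[of _ "\<lambda>x. f' (g x) * g' x"] conjI allI DERIV_chain2[of f]
          smooth_expr.mult[of "\<lambda>x. f' (g x)" g'] smooth_expr.comp[of f' g]) blast+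
qed

lemma smooth_expr_imp_smooth:
  assumes "smooth_expr f"
  shows "smooth f"
proof (rule smooth_coinduct)
  show "f \<in> Collect smooth_expr" using assms by simp
  show "\<exists>g'\<in>Collect smooth_expr. \<forall>x. (g has_real_derivative g' x) (at x)"
    if "g \<in> Collect smooth_expr" for g
    using smooth_expr_derivative[of g] that by blast
qed

lemma smooth_add: "smooth f \<Longrightarrow> smooth g \<Longrightarrow> smooth (\<lambda>x. f x + g x)"
  and smooth_mult: "smooth f \<Longrightarrow> smooth g \<Longrightarrow> smooth (\<lambda>x. f x * g x)"
  and smooth_compose: "smooth f \<Longrightarrow> smooth g \<Longrightarrow> smooth (\<lambda>x. f (g x))"
  using smooth_expr_imp_smooth smooth_expr.add[OF base base] smooth_expr.mult[OF base base]
    smooth_expr.comp[OF base base]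
  by blast+

lemma smooth_const: "smooth (\<lambda>_. c)"
proof (rule smooth_coinduct[OF rangeI[of "\<lambda>c _. c"]])
  fix f :: "real \<Rightarrow> real" assume "f \<in> range (\<lambda>c _. c)"
  then show "\<exists>f'\<in>range (\<lambda>c _. c). \<forall>x. (f has_real_derivative f' x) (at x)"
    by (intro bexI[of _ "\<lambda>_. 0"]) auto
qed

lemma smooth_ident: "smooth (\<lambda>x. x)"
proof (rule smooth_coinduct[of _ "insert (\<lambda>x. x) {f. smooth f}"])
  fix f :: "real \<Rightarrow> real" assume "f \<in> insert (\<lambda>x. x) {f. smooth f}"
  then consider "f = (\<lambda>x. x)" | "smooth f" by blast
  then show "\<exists>f'\<in>insert (\<lambda>x. x) {f. smooth f}. \<forall>x. (f has_real_derivative f' x) (at x)"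
  proof cases
    case 1
    then show ?thesis by (intro bexI[of _ "\<lambda>_. 1"]) (auto simp: smooth_const)
  next
    case 2
    then show ?thesis by (intro bexI[of _ "deriv f"]) (auto simp: smooth_deriv smooth_DERIV)
  qed
qed simp

lemma smooth_cos: "smooth cos"
\<comment> \<open>The span of \<open>cos\<close> and \<open>sin\<close> is closed under
  differentiation; \<open>cos\<close> alone is not.\<close>
proof (rule smooth_coinduct[of _ "range (\<lambda>(a, b) x. a * cos x + b * sin x)"])
  show "cos \<in> range (\<lambda>(a, b) x. a * cos x + b * sin x :: real)"
    by (rule range_eqI[of _ _ "(1, 0)"]) auto
next
  fix f assume "f \<in> range (\<lambda>(a, b) x. a * cos x + b * sin x :: real)"
  then obtain a b where f: "f = (\<lambda>x. a * cos x + b * sin x)" by auto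
  have "(f has_real_derivative (\<lambda>(a, b) x. a * cos x + b * sin x) (b, - a) x) (at x)" for x
    unfolding f by (auto intro!: derivative_eq_intros)
  then show "\<exists>f'\<in>range (\<lambda>(a, b) x. a * cos x + b * sin x). \<forall>x. (f has_real_derivative f' x) (at x)"
    by blast
qed

lemma smooth_sum:
  assumes "\<And>i. i \<in> I \<Longrightarrow> smooth (f i)"
  shows "smooth (\<lambda>x. \<Sum>i\<in>I. f i x)"
  using assms by (induction I rule: infinite_finite_induct) (simp_all add: smooth_const smooth_add)

lemma smooth_power: "smooth f \<Longrightarrow> smooth (\<lambda>x. f x ^ n)"
  by (induction n) (simp_all add: smooth_const smooth_mult)

section \<open>A flat function and a smooth cutoff\<close>

lemma tendsto_poly_times_exp_neg:
  fixes p :: "real poly"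
  shows "((\<lambda>y. poly p y * exp (- y)) \<longlongrightarrow> 0) at_top"
proof -
  have "((\<lambda>y. \<Sum>i\<le>degree p. coeff p i * (y ^ i / exp y)) \<longlongrightarrow> (\<Sum>i\<le>degree p. coeff p i * 0)) at_top"
    by (intro tendsto_intros tendsto_power_div_exp_0)
  then show ?thesis by (simp add: poly_altdef exp_minus field_simps sum_divide_distrib)
qed

text \<open>The family closed under differentiation consists of p(1/x) exp(-1/x), extended by 0, for
  polynomials p. With y = 1/x and dy/dx = -y^2, the derivative of p(y) exp(-y) is (p(y) - p'(y)) y^2
  exp(-y), which explains \<open>q\<close>.\<close>

lemma smooth_exp_neg_inverse:
  "smooth (\<lambda>x. if 0 < x then exp (- (1 / x)) else 0)"
proof -
  define \<phi> where "\<phi> p x = (if 0 < x then poly p (1 / x) * exp (- (1 / x)) else 0)" for p and x :: real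
  have "\<exists>f'\<in>range \<phi>. \<forall>x. (f has_real_derivative f' x) (at x)" if f: "f \<in> range \<phi>" for f
  proof -
    obtain p where p: "f = \<phi> p" using f by blast
    define q where "q = (p - pderiv p) * [:0, 0, 1:]"
    have "(\<phi> p has_real_derivative \<phi> q x) (at x)" for x
    proof (cases x "0 :: real" rule: linorder_cases)
      case less
      have "((\<lambda>_. 0) has_real_derivative 0) (at x)" by simp
      then have "(\<phi> p has_real_derivative 0) (at x)"
        by (rule has_field_derivative_transform_within_open[where S = "{..<0}"])
           (use less in \<open>auto simp: \<phi>_def\<close>)
      then show ?thesis using less by (simp add: \<phi>_def)
    next
      case greater
      have "((\<lambda>x. poly p (1 / x) * exp (- (1 / x))) has_real_derivative
          poly q (1 / x) * exp (- (1 / x))) (at x)"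
        using greater
        by (auto intro!: derivative_eq_intros DERIV_chain'[OF _ poly_DERIV]
            simp: q_def field_simps power2_eq_square)
      then have "(\<phi> p has_real_derivative poly q (1 / x) * exp (- (1 / x))) (at x)"
        by (rule has_field_derivative_transform_within_open[where S = "{0<..}"])
           (use greater in \<open>auto simp: \<phi>_def\<close>)
      then show ?thesis using greater by (simp add: \<phi>_def)
    next
      case equal
      \<comment> \<open>The difference quotient at 0 is y p(y) exp(-y) with y = 1/h, hence the extra
        factor \<open>[:0, 1:]\<close>.\<close>
      have right: "((\<lambda>h. \<phi> p h / h) \<longlongrightarrow> 0) (at_right 0)"
      proof -
        have "((\<lambda>y. poly (p * [:0, 1:]) y * exp (- y)) \<longlongrightarrow> 0) at_top"
          by (rule tendsto_poly_times_exp_neg)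
        then have "((\<lambda>h. poly (p * [:0, 1:]) (inverse h) * exp (- inverse h)) \<longlongrightarrow> 0) (at_right 0)"
          by (rule filterlim_compose[OF _ filterlim_inverse_at_top_right])
        then show ?thesis
          by (rule Lim_transform_eventually)
             (auto simp: eventually_at_right_field \<phi>_def field_simps intro!: exI[of _ 1])
      qed
      have left: "((\<lambda>h. \<phi> p h / h) \<longlongrightarrow> 0) (at_left 0)"
        by (rule tendsto_eventually) (auto simp: eventually_at_left_field \<phi>_def intro!: exI[of _ "-1"])
      have "((\<lambda>h. \<phi> p h / h) \<longlongrightarrow> 0) (at 0)"
        using filterlim_split_at[OF left right] .
      then show ?thesis using equal by (simp add: has_field_derivative_iff \<phi>_def)
    qed
    then show ?thesis using p by blast
  qed
  then have "smooth (\<phi> 1)" by (rule smooth_coinduct[OF rangeI])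
  then show ?thesis by (simp add: \<phi>_def[abs_def] cong: if_cong)
qed

text \<open>Rescaled to \<open>\<psi> (e * x)\<close>, it tends to 1 pointwise as e tends to 0
  because \<open>\<psi> 0 = 1\<close>, while its derivative is at most K e. Outside radius 1/e both
  the function and its derivative vanish.\<close>

lemma smooth_bump:
  obtains \<psi> K where "smooth \<psi>" "\<psi> 0 = 1" "\<And>x. 0 \<le> \<psi> x \<and> \<psi> x \<le> 1"
    "\<And>x. 1 \<le> \<bar>x\<bar> \<Longrightarrow> \<psi> x = 0" "\<And>x. 1 < \<bar>x\<bar> \<Longrightarrow> deriv \<psi> x = 0" "\<And>x. \<bar>deriv \<psi> x\<bar> \<le> K"
proof -
  define \<phi> where "\<phi> x = (if 0 < x then exp (- (1 / x)) else 0)" for x :: real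
  \<comment> \<open>The factor \<open>exp 1\<close> cancels \<open>\<phi> 1 = exp (- 1)\<close> and
    normalises \<open>\<psi> 0 = 1\<close>.\<close>
  define \<psi> where "\<psi> x = exp 1 * \<phi> (1 + (- 1) * x ^ 2)" for x
  have smooth: "smooth \<psi>"
  proof -
    have "smooth (\<lambda>x. (- 1) * x ^ 2)"
      by (rule smooth_mult[OF smooth_const smooth_power[OF smooth_ident]])
    then have "smooth (\<lambda>x. 1 + (- 1) * x ^ 2)"
      by (rule smooth_add[OF smooth_const])
    moreover have "smooth \<phi>"
      using smooth_exp_neg_inverse by (simp add: \<phi>_def[abs_def])
    ultimately have "smooth (\<lambda>x. \<phi> (1 + (- 1) * x ^ 2))"
      by (rule smooth_compose[rotated])
    then show ?thesis unfolding \<psi>_def[abs_def] by (rule smooth_mult[OF smooth_const])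
  qed
  have bounds: "0 \<le> \<psi> x \<and> \<psi> x \<le> 1" for x
  proof (cases "0 < 1 - x\<^sup>2")
    case True
    then have "1 + - (1 / (1 - x\<^sup>2)) \<le> 0" by (simp add: pos_le_divide_eq)
    then have "exp (1 + - (1 / (1 - x\<^sup>2))) \<le> 1" by simp
    then have "exp 1 * exp (- (1 / (1 - x\<^sup>2))) \<le> 1" by (simp only: exp_add)
    with True show ?thesis by (simp add: \<psi>_def \<phi>_def)
  qed (simp add: \<psi>_def \<phi>_def)
  have zero: "\<psi> x = 0" if "1 \<le> \<bar>x\<bar>" for x
  proof -
    have "1 \<le> x\<^sup>2" using that by (metis one_le_power power2_abs)
    then show ?thesis by (simp add: \<psi>_def \<phi>_def)
  qed
  have "compact (deriv \<psi> ` {-1..1})"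
    by (intro compact_continuous_image smooth_continuous_on smooth_deriv smooth compact_Icc)
  then obtain K where K: "\<And>x. x \<in> {-1..1} \<Longrightarrow> \<bar>deriv \<psi> x\<bar> \<le> K"
    by (fastforce dest!: compact_imp_bounded simp: bounded_iff)
  have deriv_zero: "deriv \<psi> x = 0" if "1 < \<bar>x\<bar>" for x
  proof -
    have "((\<lambda>_. 0) has_real_derivative 0) (at x)" by simp
    then have "(\<psi> has_real_derivative 0) (at x)"
      by (rule has_field_derivative_transform_within_open[where S = "- {-1..1}"])
         (use that in \<open>auto intro!: zero simp: abs_if split: if_splits\<close>)
    then show ?thesis by (rule DERIV_imp_deriv)
  qed
  have "\<bar>deriv \<psi> x\<bar> \<le> K" for x
    using K[of x] K[of 0] deriv_zero[of x] by (cases "1 < \<bar>x\<bar>") (auto simp: not_less abs_le_iff)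
  moreover have "\<psi> 0 = 1" by (simp add: \<psi>_def \<phi>_def flip: exp_add)
  ultimately show thesis using that smooth bounds zero deriv_zero by blast
qed

section \<open>Linear algebra and one-dimensional inequalities\<close>

text \<open>With \<open>T = tan (c (x - (a + b) / 2))\<close> one has
  \<open>(U')\<^sup>2 - c\<^sup>2 U\<^sup>2 = (U' + c T U)\<^sup>2 - (c T U\<^sup>2)'\<close>. Taking \<open>c < \<pi> / (b - a)\<close> keeps \<open>T\<close> finite up to the
  end points; the sharp constant follows by letting \<open>c\<close> tend to \<open>\<pi> / (b - a)\<close>.\<close>

lemma dirichlet_inequality_aux:
  fixes U U' :: "real \<Rightarrow> real"
  assumes "a < b" and c: "0 \<le> c" "c * (b - a) < pi"
    and deriv: "\<And>x. x \<in> {a..b} \<Longrightarrow> (U has_real_derivative U' x) (at x within {a..b})"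
    and cont: "continuous_on {a..b} U'" and U0: "U a = 0" "U b = 0"
  shows "c\<^sup>2 * integral {a..b} (\<lambda>x. (U x)\<^sup>2) \<le> integral {a..b} (\<lambda>x. (U' x)\<^sup>2)"
proof -
  define \<theta> where "\<theta> x = c * (x - a) - c * (b - a) / 2" for x
  have contU: "continuous_on {a..b} U"
    using deriv by (meson DERIV_continuous_on)
  have cos_pos: "0 < cos (\<theta> x)" if x: "x \<in> {a..b}" for x
  proof (rule cos_gt_zero_pi)
    have "0 \<le> c * (x - a)" "c * (x - a) \<le> c * (b - a)"
      using x c by (auto intro!: mult_left_mono)
    then show "- (pi / 2) < \<theta> x" "\<theta> x < pi / 2" using c by (auto simp: \<theta>_def)
  qed
  have contT: "continuous_on {a..b} (\<lambda>x. tan (\<theta> x))"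
    unfolding \<theta>_def[abs_def]
    by (intro continuous_intros) (use cos_pos in \<open>force simp: \<theta>_def\<close>)
  have "((\<lambda>x. (U' x + c * tan (\<theta> x) * U x)\<^sup>2 - ((U' x)\<^sup>2 - c\<^sup>2 * (U x)\<^sup>2)) has_integral
      c * tan (\<theta> b) * (U b)\<^sup>2 - c * tan (\<theta> a) * (U a)\<^sup>2) {a..b}"
  proof (rule fundamental_theorem_of_calculus)
    fix x assume x: "x \<in> {a..b}"
    have eq: "inverse ((cos (\<theta> x))\<^sup>2) = 1 + (tan (\<theta> x))\<^sup>2"
      using cos_pos[OF x] by (metis less_irrefl tan_sec power_inverse)
    have "(\<theta> has_real_derivative c) (at x within {a..b})"
      unfolding \<theta>_def[abs_def] by (auto intro!: derivative_eq_intros)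
    then have "((\<lambda>x. tan (\<theta> x)) has_real_derivative (1 + (tan (\<theta> x))\<^sup>2) * c) (at x within {a..b})"
      using DERIV_chain2[OF DERIV_tan] cos_pos[OF x] eq by force
    from DERIV_mult[OF DERIV_cmult[OF this, of c] DERIV_power[OF deriv[OF x], of 2]]
    have "((\<lambda>x. c * tan (\<theta> x) * (U x)\<^sup>2) has_real_derivative
        (U' x + c * tan (\<theta> x) * U x)\<^sup>2 - ((U' x)\<^sup>2 - c\<^sup>2 * (U x)\<^sup>2)) (at x within {a..b})"
      by (rule DERIV_cong) (simp add: algebra_simps power2_eq_square)
    then show "((\<lambda>x. c * tan (\<theta> x) * (U x)\<^sup>2) has_vector_derivative
        (U' x + c * tan (\<theta> x) * U x)\<^sup>2 - ((U' x)\<^sup>2 - c\<^sup>2 * (U x)\<^sup>2)) (at x within {a..b})"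
      by (simp add: has_real_derivative_iff_has_vector_derivative)
  qed (use \<open>a < b\<close> in simp)
  then have "integral {a..b} (\<lambda>x. (U' x + c * tan (\<theta> x) * U x)\<^sup>2 - ((U' x)\<^sup>2 - c\<^sup>2 * (U x)\<^sup>2)) = 0"
    using U0 by (simp add: integral_unique)
  moreover have "integral {a..b} (\<lambda>x. (U' x + c * tan (\<theta> x) * U x)\<^sup>2 - ((U' x)\<^sup>2 - c\<^sup>2 * (U x)\<^sup>2)) =
      integral {a..b} (\<lambda>x. (U' x + c * tan (\<theta> x) * U x)\<^sup>2) -
      (integral {a..b} (\<lambda>x. (U' x)\<^sup>2) - c\<^sup>2 * integral {a..b} (\<lambda>x. (U x)\<^sup>2))"
    by (subst Henstock_Kurzweil_Integration.integral_diff integral_mult_right[symmetric],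
        intro integrable_continuous_real continuous_intros contU cont contT,
        intro integrable_continuous_real continuous_intros contU cont contT)+ simp
  moreover have "0 \<le> integral {a..b} (\<lambda>x. (U' x + c * tan (\<theta> x) * U x)\<^sup>2)"
    by (intro integral_nonneg integrable_continuous_real continuous_intros contU cont contT) auto
  ultimately show ?thesis by simp
qed

lemma dirichlet_inequality:
  fixes U U' :: "real \<Rightarrow> real"
  assumes "a < b"
    and deriv: "\<And>x. x \<in> {a..b} \<Longrightarrow> (U has_real_derivative U' x) (at x within {a..b})"
    and cont: "continuous_on {a..b} U'" and U0: "U a = 0" "U b = 0"
  shows "(pi / (b - a))\<^sup>2 * integral {a..b} (\<lambda>x. (U x)\<^sup>2) \<le> integral {a..b} (\<lambda>x. (U' x)\<^sup>2)"
proof (rule tendsto_upperbound)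
  show "((\<lambda>c. c\<^sup>2 * integral {a..b} (\<lambda>x. (U x)\<^sup>2)) \<longlongrightarrow>
      (pi / (b - a))\<^sup>2 * integral {a..b} (\<lambda>x. (U x)\<^sup>2)) (at_left (pi / (b - a)))"
    by (intro tendsto_intros)
  have "0 < pi / (b - a)" using \<open>a < b\<close> by simp
  then have "\<forall>\<^sub>F c in at_left (pi / (b - a)). c \<in> {0<..<pi / (b - a)}"
    by (rule eventually_at_left_real)
  then show "\<forall>\<^sub>F c in at_left (pi / (b - a)).
      c\<^sup>2 * integral {a..b} (\<lambda>x. (U x)\<^sup>2) \<le> integral {a..b} (\<lambda>x. (U' x)\<^sup>2)"
  proof eventually_elim
    case (elim c)
    then show ?case
      using \<open>a < b\<close> by (intro dirichlet_inequality_aux assms) (auto simp: field_simps)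
  qed
qed simp

text \<open>With \<open>U\<close> the primitive of \<open>u\<close> vanishing at both ends, \<open>\<integral>u\<^sup>2 = - \<integral>U u'\<close>, which is estimated by
  \<open>\<integral>u\<^sup>2 / 2 + (L / \<pi>)\<^sup>2 \<integral>u'\<^sup>2 / 2\<close> using the inequality for \<open>U\<close>.\<close>

lemma wirtinger_inequality:
  fixes u u' :: "real \<Rightarrow> real"
  assumes "a < b"
    and deriv: "\<And>x. (u has_real_derivative u' x) (at x)"
    and cont: "continuous_on {a..b} u'" and mean: "integral {a..b} u = 0"
  shows "(pi / (b - a))\<^sup>2 * integral {a..b} (\<lambda>x. (u x)\<^sup>2) \<le> integral {a..b} (\<lambda>x. (u' x)\<^sup>2)"
proof -
  define \<kappa> where "\<kappa> = pi / (b - a)"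
  have \<kappa>: "0 < \<kappa>" using \<open>a < b\<close> by (simp add: \<kappa>_def)
  define U where "U x = integral {a..x} u" for x
  have contu: "continuous_on {a..b} u"
    using deriv by (meson DERIV_isCont continuous_at_imp_continuous_on)
  have U: "(U has_real_derivative u x) (at x within {a..b})" if "x \<in> {a..b}" for x
    unfolding U_def[abs_def] by (rule integral_has_real_derivative[OF contu that])
  have U0: "U a = 0" "U b = 0" using mean by (simp_all add: U_def)
  have contU: "continuous_on {a..b} U" using U by (meson DERIV_continuous_on)
  have dir: "\<kappa>\<^sup>2 * integral {a..b} (\<lambda>x. (U x)\<^sup>2) \<le> integral {a..b} (\<lambda>x. (u x)\<^sup>2)"
    unfolding \<kappa>_def by (rule dirichlet_inequality[OF \<open>a < b\<close> U contu U0])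
  have "((\<lambda>x. u x * u x + U x * u' x) has_integral U b * u b - U a * u a) {a..b}"
  proof (rule fundamental_theorem_of_calculus)
    fix x assume x: "x \<in> {a..b}"
    show "((\<lambda>x. U x * u x) has_vector_derivative u x * u x + U x * u' x) (at x within {a..b})"
      unfolding has_real_derivative_iff_has_vector_derivative[symmetric]
      by (rule DERIV_cong[OF DERIV_mult[OF U[OF x] has_field_derivative_at_within[OF deriv]]])
         (simp add: algebra_simps)
  qed (use \<open>a < b\<close> in simp)
  then have "integral {a..b} (\<lambda>x. u x * u x + U x * u' x) = 0"
    using U0 by (simp add: integral_unique)
  \<comment> \<open>The left side is 0 by the integration by parts above. The two integrands differ
    by the square \<open>(\<kappa>\<^sup>2 * U x + u' x)\<^sup>2\<close>, which is the weighted
    estimate of U u' cleared of denominators.\<close>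
  moreover have "integral {a..b} (\<lambda>x. 2 * \<kappa>\<^sup>2 * (u x * u x + U x * u' x)) \<ge>
      integral {a..b} (\<lambda>x. 2 * \<kappa>\<^sup>2 * (u x)\<^sup>2 - \<kappa>\<^sup>2 * (\<kappa>\<^sup>2 * (U x)\<^sup>2) - (u' x)\<^sup>2)"
  proof (rule integral_le)
    fix x
    have "0 \<le> (\<kappa>\<^sup>2 * U x + u' x)\<^sup>2" by simp
    then show "2 * \<kappa>\<^sup>2 * (u x)\<^sup>2 - \<kappa>\<^sup>2 * (\<kappa>\<^sup>2 * (U x)\<^sup>2) - (u' x)\<^sup>2 \<le> 2 * \<kappa>\<^sup>2 * (u x * u x + U x * u' x)"
      by (simp add: power2_eq_square algebra_simps)
  qed (intro integrable_continuous_real continuous_intros contu contU cont)+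
  moreover have "integral {a..b} (\<lambda>x. 2 * \<kappa>\<^sup>2 * (u x)\<^sup>2 - \<kappa>\<^sup>2 * (\<kappa>\<^sup>2 * (U x)\<^sup>2) - (u' x)\<^sup>2) =
      2 * \<kappa>\<^sup>2 * integral {a..b} (\<lambda>x. (u x)\<^sup>2) - \<kappa>\<^sup>2 * (\<kappa>\<^sup>2 * integral {a..b} (\<lambda>x. (U x)\<^sup>2)) -
      integral {a..b} (\<lambda>x. (u' x)\<^sup>2)"
    by (subst Henstock_Kurzweil_Integration.integral_diff,
        intro integrable_continuous_real continuous_intros contu contU cont,
        intro integrable_continuous_real continuous_intros contu contU cont)+ simp
  ultimately have "2 * \<kappa>\<^sup>2 * integral {a..b} (\<lambda>x. (u x)\<^sup>2) - \<kappa>\<^sup>2 * (\<kappa>\<^sup>2 * integral {a..b} (\<lambda>x. (U x)\<^sup>2)) \<le>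
      integral {a..b} (\<lambda>x. (u' x)\<^sup>2)" by simp
  moreover have "\<kappa>\<^sup>2 * (\<kappa>\<^sup>2 * integral {a..b} (\<lambda>x. (U x)\<^sup>2)) \<le> \<kappa>\<^sup>2 * integral {a..b} (\<lambda>x. (u x)\<^sup>2)"
    by (rule mult_left_mono[OF dir]) simp
  ultimately show ?thesis by (simp add: \<kappa>_def)
qed

text \<open>Gaussian elimination, one equation per induction step. It later produces, in a space of
  dimension k + 1, a nonzero element annihilated by at most k functionals.\<close>

lemma underdetermined_system:
  fixes A :: "'i \<Rightarrow> 'b \<Rightarrow> real"
  assumes "finite I" "finite B" "card I < card B"
  shows "\<exists>c. (\<exists>b\<in>B. c b \<noteq> 0) \<and> (\<forall>i\<in>I. (\<Sum>b\<in>B. c b * A i b) = 0)"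
  using assms
proof (induction I arbitrary: A B rule: finite_induct)
  case empty
  then have "B \<noteq> {}" by auto
  then show ?case by (intro exI[of _ "\<lambda>_. 1"]) auto
next
  case (insert j I)
  show ?case
  proof (cases "\<exists>b\<in>B. A j b \<noteq> 0")
    case False
    moreover have "\<exists>c. (\<exists>b\<in>B. c b \<noteq> 0) \<and> (\<forall>i\<in>I. (\<Sum>b\<in>B. c b * A i b) = 0)"
      using insert.prems insert.hyps by (intro insert.IH) auto
    ultimately show ?thesis by auto
  next
    case True
    then obtain p where p: "p \<in> B" "A j p \<noteq> 0" by blast
    \<comment> \<open>Subtracting \<open>t b\<close> times column \<open>p\<close> from column
      \<open>b\<close> clears row \<open>j\<close>, which leaves a system with one equation and one
      unknown less.\<close>
    define t where "t b = A j b / A j p" for b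
    have "\<exists>c. (\<exists>b\<in>B - {p}. c b \<noteq> 0) \<and> (\<forall>i\<in>I. (\<Sum>b\<in>B - {p}. c b * (A i b - A i p * t b)) = 0)"
      using insert.prems insert.hyps p by (intro insert.IH) auto
    then obtain c where c: "\<exists>b\<in>B - {p}. c b \<noteq> 0"
      "\<And>i. i \<in> I \<Longrightarrow> (\<Sum>b\<in>B - {p}. c b * (A i b - A i p * t b)) = 0" by blast
    \<comment> \<open>The coefficient at \<open>p\<close> gathers what the column operations
      subtracted, so that \<open>d\<close> combines the original columns as \<open>c\<close>
      combines the reduced ones.\<close>
    define d where "d = c(p := - (\<Sum>b\<in>B - {p}. c b * t b))"
    have sum_d: "(\<Sum>b\<in>B. d b * A i b) = (\<Sum>b\<in>B - {p}. c b * (A i b - A i p * t b))" for i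
    proof -
      have "(\<Sum>b\<in>B. d b * A i b) = d p * A i p + (\<Sum>b\<in>B - {p}. d b * A i b)"
        using p insert.prems by (simp add: sum.remove)
      also have "(\<Sum>b\<in>B - {p}. d b * A i b) = (\<Sum>b\<in>B - {p}. c b * A i b)"
        by (rule sum.cong) (auto simp: d_def)
      finally show ?thesis
        by (simp add: d_def algebra_simps sum_subtractf sum_distrib_left)
    qed
    have "(\<Sum>b\<in>B. d b * A j b) = 0"
      unfolding sum_d using p by (simp add: t_def)
    then have "\<forall>i\<in>insert j I. (\<Sum>b\<in>B. d b * A i b) = 0"
      using c(2) sum_d by auto
    moreover have "\<exists>b\<in>B. d b \<noteq> 0" using c(1) by (auto simp: d_def)
    ultimately show ?thesis by blast
  qed
qed

text \<open>The point is that one n serves all vectors c. There are finitely many entries, so they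
  are eventually all within e of the limit, and such an error changes the form by at most e
  (\<Sum>\<bar>c i\<bar>)^2.\<close>

lemma eventually_positive_definite:
  fixes D :: "nat \<Rightarrow> nat \<Rightarrow> nat \<Rightarrow> real"
  assumes lim: "\<And>i j. i \<le> k \<Longrightarrow> j \<le> k \<Longrightarrow> (\<lambda>n. D n i j) \<longlonglongrightarrow> (if i = j then d i else 0)"
    and pos: "\<And>i. i \<le> k \<Longrightarrow> 0 < d i"
  shows "\<forall>\<^sub>F n in sequentially. \<forall>c. (\<exists>i\<le>k. c i \<noteq> 0) \<longrightarrow>
    0 < (\<Sum>i\<le>k. \<Sum>j\<le>k. c i * c j * D n i j)"
proof -
  define \<delta> where "\<delta> = Min (d ` {..k})"
  have \<delta>: "0 < \<delta>" "\<And>i. i \<le> k \<Longrightarrow> \<delta> \<le> d i"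
    using pos by (auto simp: \<delta>_def)
  \<comment> \<open>By Cauchy-Schwarz (\<Sum>\<bar>c i\<bar>)^2 is at most (k + 1) \<Sum>(c i)^2, so
    this choice loses only half of the lower bound \<delta> \<Sum>(c i)^2.\<close>
  define e where "e = \<delta> / (2 * real (k + 1))"
  have e: "0 < e" using \<delta> by (simp add: e_def)
  have "\<forall>\<^sub>F n in sequentially. \<forall>i\<in>{..k}. \<forall>j\<in>{..k}. \<bar>D n i j - (if i = j then d i else 0)\<bar> < e"
  proof (intro eventually_ball_finite ballI finite_atMost)
    fix i j assume "i \<in> {..k}" "j \<in> {..k}"
    then have "(\<lambda>n. D n i j) \<longlonglongrightarrow> (if i = j then d i else 0)" by (intro lim) auto
    from tendstoD[OF this e]
    show "\<forall>\<^sub>F n in sequentially. \<bar>D n i j - (if i = j then d i else 0)\<bar> < e"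
      by (simp add: dist_real_def)
  qed
  then show ?thesis
  proof eventually_elim
    case (elim n)
    show ?case
    proof (intro allI impI)
      fix c :: "nat \<Rightarrow> real" assume nz: "\<exists>i\<le>k. c i \<noteq> 0"
      define s where "s = (\<Sum>i\<le>k. (c i)\<^sup>2)"
      obtain i0 where "i0 \<le> k" "c i0 \<noteq> 0" using nz by blast
      then have s: "0 < s" unfolding s_def by (intro sum_pos2[of _ i0]) auto
      have cs: "(\<Sum>i\<le>k. \<bar>c i\<bar>)\<^sup>2 \<le> real (k + 1) * s"
        using sum_squared_le_sum_of_squares[of "\<lambda>i. \<bar>c i\<bar>" "{..k}"] by (simp add: s_def mult.commute)
      have entry: "(if i = j then \<delta> * (c i)\<^sup>2 else 0) - e * (\<bar>c i\<bar> * \<bar>c j\<bar>) \<le> c i * c j * D n i j"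
        if ij: "i \<le> k" "j \<le> k" for i j
      proof -
        define r where "r = D n i j - (if i = j then d i else 0)"
        have "\<bar>r\<bar> \<le> e" using elim ij by (auto simp: r_def less_imp_le)
        then have "\<bar>c i * c j * r\<bar> \<le> e * (\<bar>c i\<bar> * \<bar>c j\<bar>)"
          using mult_left_mono[of "\<bar>r\<bar>" e "\<bar>c i\<bar> * \<bar>c j\<bar>"] by (simp add: abs_mult mult.commute)
        moreover have "(if i = j then \<delta> * (c i)\<^sup>2 else 0) \<le> c i * c j * (if i = j then d i else 0)"
          using mult_right_mono[OF \<delta>(2)[OF ij(1)], of "(c i)\<^sup>2"] by (cases "i = j") (simp_all add: power2_eq_square mult_ac)
        moreover have "c i * c j * D n i j = c i * c j * (if i = j then d i else 0) + c i * c j * r"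
          by (simp add: r_def algebra_simps)
        ultimately show ?thesis by linarith
      qed
      have "(\<Sum>i\<le>k. \<Sum>j\<le>k. (if i = j then \<delta> * (c i)\<^sup>2 else 0) - e * (\<bar>c i\<bar> * \<bar>c j\<bar>)) \<le>
          (\<Sum>i\<le>k. \<Sum>j\<le>k. c i * c j * D n i j)"
        by (intro sum_mono entry) auto
      moreover have "(\<Sum>i\<le>k. \<Sum>j\<le>k. (if i = j then \<delta> * (c i)\<^sup>2 else 0) - e * (\<bar>c i\<bar> * \<bar>c j\<bar>)) =
          \<delta> * s - e * (\<Sum>i\<le>k. \<bar>c i\<bar>)\<^sup>2"
        unfolding power2_eq_square[of "\<Sum>i\<le>k. \<bar>c i\<bar>"] sum_product
        by (simp add: sum_subtractf sum_distrib_left s_def)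
      moreover have "e * (\<Sum>i\<le>k. \<bar>c i\<bar>)\<^sup>2 \<le> \<delta> / 2 * s"
      proof -
        have "e * (real (k + 1) * s) = \<delta> / 2 * s" by (simp add: e_def divide_simps)
        then show ?thesis using mult_left_mono[OF cs less_imp_le[OF e]] by linarith
      qed
      moreover have "0 < \<delta> / 2 * s" using \<delta> s by simp
      ultimately show "0 < (\<Sum>i\<le>k. \<Sum>j\<le>k. c i * c j * D n i j)" by (simp add: field_simps)
    qed
  qed
qed

section \<open>Approximation, test functions and the primitive of a density\<close>

lemma Lipschitz_1_continuous_on:
  fixes F :: "real \<Rightarrow> real"
  assumes "\<And>x y. \<bar>F x - F y\<bar> \<le> \<bar>x - y\<bar>"
  shows "continuous_on A F"
proof (rule lipschitz_on_continuous_on)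
  show "1-lipschitz_on A F" using assms by (intro lipschitz_onI) (auto simp: dist_real_def)
qed

text \<open>The average \<open>S\<close> of F over [x, x + h] is close to F, and its derivative
  \<open>g\<close> is a difference quotient of F, hence continuous and bounded by 1. A Weierstrass
  polynomial for \<open>g\<close> is integrated to obtain \<open>G\<close>; approximating F itself
  by polynomials would give no control of slopes.\<close>

lemma smooth_approx_Lipschitz:
  fixes F :: "real \<Rightarrow> real"
  assumes lip: "\<And>x y. \<bar>F x - F y\<bar> \<le> \<bar>x - y\<bar>" and "0 < e" "0 < R"
  obtains G where "smooth G"
    "\<And>x. \<bar>x\<bar> \<le> R \<Longrightarrow> \<bar>deriv G x\<bar> \<le> 1 + e" "\<And>x. \<bar>x\<bar> \<le> R \<Longrightarrow> \<bar>G x - F x\<bar> \<le> e"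
proof -
  define h where "h = e / 2"
  have h: "0 < h" using \<open>0 < e\<close> by (simp add: h_def)
  have contF: "continuous_on A F" for A
    by (rule Lipschitz_1_continuous_on[OF lip])
  \<comment> \<open>For \<bar>x\<bar> \<le> R both x and x + h lie inside (-A, A), where \<Phi> is
    differentiable on both sides.\<close>
  define A where "A = R + h + 1"
  define \<Phi> where "\<Phi> x = integral {-A..x} F" for x
  have \<Phi>: "(\<Phi> has_real_derivative F x) (at x)" if "- A < x" "x < A" for x
  proof -
    have "(\<Phi> has_real_derivative F x) (at x within {-A..A})"
      unfolding \<Phi>_def[abs_def] by (rule integral_has_real_derivative[OF contF]) (use that in auto)
    then show ?thesis using at_within_interior[of x "{-A..A}"] that by simp
  qed
  define S where "S x = (\<Phi> (x + h) - \<Phi> x) / h" for x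
  define g where "g x = (F (x + h) - F x) / h" for x
  have S': "(S has_real_derivative g x) (at x)" if "\<bar>x\<bar> \<le> R" for x
  proof -
    have "((\<lambda>x. \<Phi> (x + h)) has_real_derivative F (x + h)) (at x)"
      unfolding DERIV_shift[symmetric] by (rule \<Phi>) (use that h in \<open>auto simp: A_def\<close>)
    moreover have "(\<Phi> has_real_derivative F x) (at x)"
      by (rule \<Phi>) (use that h in \<open>auto simp: A_def\<close>)
    ultimately show ?thesis
      unfolding S_def[abs_def] g_def by (intro DERIV_cdivide DERIV_diff)
  qed
  have S_F: "\<bar>S x - F x\<bar> \<le> e / 2" if "\<bar>x\<bar> \<le> R" for x
  proof -
    have "\<exists>z>x. z < x + h \<and> \<Phi> (x + h) - \<Phi> x = (x + h - x) * F z"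
      by (rule MVT2) (use h that in \<open>auto simp: A_def intro!: \<Phi>\<close>)
    then obtain z where z: "x < z" "z < x + h" "S x = F z" using h by (auto simp: S_def)
    then show ?thesis using lip[of z x] by (simp add: h_def)
  qed
  \<comment> \<open>The first bound keeps \<bar>p\<bar> \<le> 1 + e. The second makes the error
    accumulated over a distance R at most e / 2; the averaging, with h = e / 2, costs the other
    half.\<close>
  define d where "d = min e (e / (2 * R))"
  have d: "0 < d" using assms by (simp add: d_def)
  have "continuous_on {-R..R} g"
  proof -
    have "continuous_on {-R..R} (\<lambda>x. F (x + h))"
      by (rule continuous_on_compose2[OF contF[of UNIV]]) (auto intro: continuous_intros)
    then show ?thesis
      unfolding g_def[abs_def] using h by (intro continuous_on_divide continuous_on_diff contF) auto
  qed
  then obtain p where p: "real_polynomial_function p" "\<And>x. x \<in> {-R..R} \<Longrightarrow> \<bar>g x - p x\<bar> < d"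
    using Stone_Weierstrass_real_polynomial_function[OF compact_Icc _ d] by blast
  obtain a n where a: "p = (\<lambda>x. \<Sum>i\<le>n. a i * x ^ i)"
    using p(1) unfolding real_polynomial_function_iff_sum by blast
  define P where "P x = (\<Sum>i\<le>n. a i / real (Suc i) * x ^ Suc i)" for x
  \<comment> \<open>The constant makes \<open>G - S\<close> vanish at 0, from where the error is
    integrated.\<close>
  define G where "G x = P x + S 0" for x
  have "smooth (\<lambda>x. a i / real (Suc i) * x ^ Suc i)" for i
    by (rule smooth_mult[OF smooth_const smooth_power[OF smooth_ident]])
  then have "smooth P" unfolding P_def[abs_def] by (intro smooth_sum)
  then have smooth: "smooth G"
    unfolding G_def[abs_def] by (rule smooth_add[OF _ smooth_const])
  have G': "(G has_real_derivative p x) (at x)" for x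
  proof -
    have "((\<lambda>x. a i / real (Suc i) * x ^ Suc i) has_real_derivative a i * x ^ i) (at x)" for i
      using DERIV_cmult[OF DERIV_pow[of "Suc i" x], of "a i / real (Suc i)"] by (simp del: of_nat_Suc)
    then have "(P has_real_derivative p x) (at x)"
      unfolding P_def[abs_def] a by (intro DERIV_sum) auto
    then show ?thesis unfolding G_def[abs_def] using DERIV_add[OF _ DERIV_const, of P "p x" x UNIV "S 0"] by simp
  qed
  have "\<bar>deriv G x\<bar> \<le> 1 + e" if "\<bar>x\<bar> \<le> R" for x
  proof -
    have "\<bar>g x\<bar> \<le> 1" using lip[of "x + h" x] h by (simp add: g_def)
    moreover have "\<bar>g x - p x\<bar> < e" using p(2)[of x] that by (simp add: d_def abs_le_iff)
    ultimately show ?thesis using DERIV_imp_deriv[OF G', of x] by linarith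
  qed
  moreover have "\<bar>G x - F x\<bar> \<le> e" if x: "\<bar>x\<bar> \<le> R" for x
  proof -
    have "norm ((G x - S x) - (G 0 - S 0)) \<le> d * norm (x - 0)"
    proof (rule field_differentiable_bound[where S = "{-R..R}"])
      fix z assume z: "z \<in> {-R..R}"
      then have "(S has_real_derivative g z) (at z)" by (intro S') auto
      then show "((\<lambda>x. G x - S x) has_real_derivative p z - g z) (at z within {-R..R})"
        by (rule has_field_derivative_at_within[OF DERIV_diff[OF G']])
      show "norm (p z - g z) \<le> d" using p(2)[OF z] by simp
    qed (use x \<open>0 < R\<close> in auto)
    also have "\<dots> \<le> e / (2 * R) * R"
      by (rule mult_mono) (use assms x in \<open>auto simp: d_def\<close>)
    also have "\<dots> = e / 2" using \<open>0 < R\<close> by simp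
    finally have "\<bar>G x - S x\<bar> \<le> e / 2" by (simp add: G_def P_def)
    then show ?thesis using S_F[OF x] by linarith
  qed
  ultimately show thesis using that smooth by blast
qed

section \<open>Test functions and their classes\<close>

lemma test_functions_iff: "u \<in> test_functions \<longleftrightarrow> smooth u \<and> compact (closure {x. u x \<noteq> 0})"
  by (simp add: test_functions_def smooth_def)

lemma test_functions_smooth: "u \<in> test_functions \<Longrightarrow> smooth u"
  by (simp add: test_functions_iff)

lemma test_functions_add:
  assumes "u \<in> test_functions" "v \<in> test_functions"
  shows "(\<lambda>x. u x + v x) \<in> test_functions"
proof -
  have "bounded ({x. u x \<noteq> 0} \<union> {x. v x \<noteq> 0})"
    using assms by (simp add: test_functions_iff)
  then have "bounded {x. u x + v x \<noteq> 0}" by (rule bounded_subset) auto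
  then show ?thesis using assms by (simp add: test_functions_iff smooth_add)
qed

lemma test_functions_scale:
  assumes "u \<in> test_functions"
  shows "(\<lambda>x. c * u x) \<in> test_functions"
proof -
  have "bounded {x. u x \<noteq> 0}" using assms by (simp add: test_functions_iff)
  then have "bounded {x. c * u x \<noteq> 0}" by (rule bounded_subset) auto
  then show ?thesis using assms by (simp add: test_functions_iff smooth_mult smooth_const)
qed

lemma test_functions_zero: "(\<lambda>_. 0) \<in> test_functions"
  by (simp add: test_functions_iff smooth_const)

lemma test_functions_sum:
  assumes "\<And>i. i \<in> I \<Longrightarrow> u i \<in> test_functions"
  shows "(\<lambda>x. \<Sum>i\<in>I. c i * u i x) \<in> test_functions"
  using assms
  by (induction I rule: infinite_finite_induct)
     (simp_all add: test_functions_zero test_functions_add test_functions_scale)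

lemma restr_add: "restr \<rho> (\<lambda>x. u x + v x) = restr \<rho> u + restr \<rho> v"
  by (simp add: restr_def plus_ae_fun.abs_eq algebra_simps)

lemma restr_scale: "restr \<rho> (\<lambda>x. c * u x) = c *\<^sub>R restr \<rho> u"
  by (simp add: restr_def scaleR_ae_fun.abs_eq algebra_simps)

lemma restr_zero: "restr \<rho> (\<lambda>_. 0) = 0"
  by (simp add: restr_def zero_ae_fun_def)

lemma restr_sum: "restr \<rho> (\<lambda>x. \<Sum>i\<in>I. c i * u i x) = (\<Sum>i\<in>I. c i *\<^sub>R restr \<rho> (u i))"
  by (induction I rule: infinite_finite_induct) (simp_all add: restr_zero restr_add restr_scale)

text \<open>Links classes to integrals: u vanishes on {\<rho> > 0} exactly where \<rho> u^2 does.
  Nonzero classes thus have positive denominators in the Rayleigh quotient.\<close>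

lemma restr_eq_zero_iff:
  assumes "\<And>x. 0 \<le> \<rho> x"
  shows "restr \<rho> u = 0 \<longleftrightarrow> (AE x in lebesgue. \<rho> x * (u x)\<^sup>2 = 0)"
proof -
  have "restr \<rho> u = 0 \<longleftrightarrow> (AE x in lebesgue. u x * indicator {y. 0 < \<rho> y} x = 0)"
    by (simp add: restr_def zero_ae_fun_def ae_fun.abs_eq_iff ae_eq_def)
  also have "\<dots> \<longleftrightarrow> (AE x in lebesgue. \<rho> x * (u x)\<^sup>2 = 0)"
    by (rule AE_cong) (use assms in \<open>auto simp: indicator_def less_le\<close>)
  finally show ?thesis .
qed

section \<open>Integration against a density and its distribution function\<close>

context
  fixes \<rho> :: "real \<Rightarrow> real"
  assumes \<rho>: "\<rho> \<in> densities"
begin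

lemma density_measurable [measurable]: "\<rho> \<in> borel_measurable lebesgue"
  and density_integrable: "integrable lebesgue \<rho>"
  and density_nonneg: "0 \<le> \<rho> x"
  and density_le_1: "\<rho> x \<le> 1"
  and density_mass_pos: "0 < integral\<^sup>L lebesgue \<rho>"
  using \<rho> by (auto simp: densities_def)

lemma integrable_density_bounded:
  assumes [measurable]: "f \<in> borel_measurable lebesgue" and "\<And>x. \<bar>f x\<bar> \<le> M"
  shows "integrable lebesgue (\<lambda>x. \<rho> x * f x)"
proof (rule Bochner_Integration.integrable_bound)
  show "integrable lebesgue (\<lambda>x. M * \<rho> x)" using density_integrable by simp
  show "AE x in lebesgue. norm (\<rho> x * f x) \<le> norm (M * \<rho> x)"
  proof (rule AE_I2)
    fix x
    have "\<bar>\<rho> x\<bar> * \<bar>f x\<bar> \<le> \<bar>\<rho> x\<bar> * \<bar>M\<bar>"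
      using assms(2)[of x] by (intro mult_left_mono) auto
    then show "norm (\<rho> x * f x) \<le> norm (M * \<rho> x)" by (simp add: abs_mult mult.commute)
  qed
qed measurable

lemma tendsto_integral_density:
  assumes [measurable]: "\<And>n. f n \<in> borel_measurable lebesgue" "g \<in> borel_measurable lebesgue"
    and bound: "\<And>n x. \<bar>f n x\<bar> \<le> M" and lim: "\<And>x. (\<lambda>n. f n x) \<longlonglongrightarrow> g x"
  shows "(\<lambda>n. \<integral>x. \<rho> x * f n x \<partial>lebesgue) \<longlonglongrightarrow> (\<integral>x. \<rho> x * g x \<partial>lebesgue)"
proof (rule integral_dominated_convergence)
  show "integrable lebesgue (\<lambda>x. \<rho> x * M)" using density_integrable by simp
  show "AE x in lebesgue. norm (\<rho> x * f n x) \<le> \<rho> x * M" for n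
    using bound density_nonneg by (intro AE_I2) (simp add: abs_mult mult_left_mono)
  show "AE x in lebesgue. (\<lambda>n. \<rho> x * f n x) \<longlonglongrightarrow> \<rho> x * g x"
    by (intro AE_I2 tendsto_intros lim)
qed measurable

definition cumul :: "real \<Rightarrow> real"
  where "cumul x = (\<integral>y. \<rho> y * indicator {..x} y \<partial>lebesgue)"

lemma integrable_density_indicator:
  assumes [measurable]: "A \<in> sets lebesgue"
  shows "integrable lebesgue (\<lambda>x. \<rho> x * indicator A x)"
  by (rule integrable_density_bounded[of _ 1]) (auto simp: indicator_def)

text \<open>The lower estimate comes from \<rho> \<ge> 0. The upper one is where the bound \<rho>
  \<le> 1 enters; it makes \<open>cumul\<close> 1-Lipschitz.\<close>

lemma cumul_increment:
  assumes "x \<le> y"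
  shows "0 \<le> cumul y - cumul x" "cumul y - cumul x \<le> y - x"
proof -
  have "cumul y - cumul x = (\<integral>z. \<rho> z * indicator {..y} z - \<rho> z * indicator {..x} z \<partial>lebesgue)"
    unfolding cumul_def
    by (rule Bochner_Integration.integral_diff[symmetric]) (rule integrable_density_indicator, simp)+
  also have "\<dots> = (\<integral>z. \<rho> z * indicator {x<..y} z \<partial>lebesgue)"
    by (rule Bochner_Integration.integral_cong) (use assms in \<open>auto simp: indicator_def\<close>)
  finally have eq: "cumul y - cumul x = (\<integral>z. \<rho> z * indicator {x<..y} z \<partial>lebesgue)" .
  show "0 \<le> cumul y - cumul x"
    unfolding eq using density_nonneg by (intro integral_nonneg_AE AE_I2) simp
  have "(\<integral>z. \<rho> z * indicator {x<..y} z \<partial>lebesgue) \<le> (\<integral>z. indicator {x<..y} z \<partial>lebesgue)"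
  proof (rule integral_mono)
    show "integrable lebesgue (indicat_real {x<..y})"
      by (rule integrable_real_indicator) (use assms in auto)
    show "\<rho> z * indicator {x<..y} z \<le> indicator {x<..y} z" for z
      using density_le_1[of z] by (auto simp: indicator_def)
  qed (simp add: integrable_density_indicator)
  also have "\<dots> = y - x" using assms by simp
  finally show "cumul y - cumul x \<le> y - x" unfolding eq .
qed

lemma cumul_Lipschitz: "\<bar>cumul x - cumul y\<bar> \<le> \<bar>x - y\<bar>"
  using cumul_increment[of x y] cumul_increment[of y x] by linarith

lemma cumul_mono: "x \<le> y \<Longrightarrow> cumul x \<le> cumul y"
  using cumul_increment(1) by force

lemma cumul_measurable [measurable]: "cumul \<in> borel_measurable borel"
  by (rule borel_measurable_mono) (simp add: mono_def cumul_mono)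

lemma cumul_continuous: "continuous_on A cumul"
  by (rule Lipschitz_1_continuous_on[OF cumul_Lipschitz])

lemma cumul_bounds: "0 \<le> cumul x" "cumul x \<le> integral\<^sup>L lebesgue \<rho>"
proof -
  show "0 \<le> cumul x"
    unfolding cumul_def using density_nonneg by (intro integral_nonneg_AE AE_I2) simp
  show "cumul x \<le> integral\<^sup>L lebesgue \<rho>"
    unfolding cumul_def
  proof (rule integral_mono)
    show "\<rho> y * indicator {..x} y \<le> \<rho> y" for y
      using density_nonneg[of y] by (simp add: indicator_def)
  qed (simp_all add: integrable_density_indicator density_integrable)
qed

lemma cumul_at_bot: "(\<lambda>n. cumul (- real n)) \<longlonglongrightarrow> 0"
proof -
  have "(\<lambda>n. \<integral>y. \<rho> y * indicator {..- real n} y \<partial>lebesgue) \<longlonglongrightarrow> (\<integral>y. \<rho> y * 0 \<partial>lebesgue)"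
  proof (rule tendsto_integral_density[of _ _ 1])
    fix x :: real
    have "\<forall>\<^sub>F n in sequentially. - x < real n"
      using filterlim_real_sequentially unfolding filterlim_at_top_dense by blast
    then show "(\<lambda>n. indicator {..- real n} x) \<longlonglongrightarrow> (0 :: real)"
      by (intro tendsto_eventually) (auto elim!: eventually_mono simp: indicator_def)
    show "\<bar>indicator {..- real n} x\<bar> \<le> (1 :: real)" for n by (simp add: indicator_def)
  next
    show "indicat_real {..- real n} \<in> borel_measurable lebesgue" for n
      by (rule borel_measurable_indicator) simp
  qed simp
  then show ?thesis by (simp add: cumul_def)
qed

lemma cumul_at_top: "(\<lambda>n. cumul (real n)) \<longlonglongrightarrow> integral\<^sup>L lebesgue \<rho>"
proof -
  have "(\<lambda>n. \<integral>y. \<rho> y * indicator {..real n} y \<partial>lebesgue) \<longlonglongrightarrow> (\<integral>y. \<rho> y * 1 \<partial>lebesgue)"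
  proof (rule tendsto_integral_density[of _ _ 1])
    fix x :: real
    have "\<forall>\<^sub>F n in sequentially. x < real n"
      using filterlim_real_sequentially unfolding filterlim_at_top_dense by blast
    then show "(\<lambda>n. indicator {..real n} x) \<longlonglongrightarrow> (1 :: real)"
      by (intro tendsto_eventually) (auto elim!: eventually_mono simp: indicator_def)
    show "\<bar>indicator {..real n} x\<bar> \<le> (1 :: real)" for n by (simp add: indicator_def)
  next
    show "indicat_real {..real n} \<in> borel_measurable lebesgue" for n
      by (rule borel_measurable_indicator) simp
  qed simp
  then show ?thesis by (simp add: cumul_def)
qed

text \<open>This is the tail function of the image of \<rho> dx under \<open>cumul\<close>; the
  right side is the tail of Lebesgue measure on [0, m]. By monotonicity the superlevel set is
  everything, empty, or an open half-line.\<close>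

lemma integral_cumul_greater:
  "(\<integral>x. \<rho> x * indicator {x. t < cumul x} x \<partial>lebesgue) =
    (if t < 0 then integral\<^sup>L lebesgue \<rho> else max 0 (integral\<^sup>L lebesgue \<rho> - t))"
proof -
  let ?m = "integral\<^sup>L lebesgue \<rho>"
  consider "\<forall>x. t < cumul x" | "\<forall>x. cumul x \<le> t" | "\<exists>x. cumul x \<le> t" "\<exists>x. t < cumul x"
    using not_le by blast
  then show ?thesis
  proof cases
    case 1
    have "t \<le> 0"
      by (rule LIMSEQ_le_const[OF cumul_at_bot]) (use 1 in \<open>blast intro: less_imp_le\<close>)
    moreover have "{x. t < cumul x} = UNIV" using 1 by auto
    ultimately show ?thesis using density_mass_pos by auto
  next
    case 2
    have "?m \<le> t" by (rule LIMSEQ_le_const2[OF cumul_at_top]) (use 2 in blast)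
    moreover have "{x. t < cumul x} = {}" using 2 by (auto simp: not_less)
    ultimately show ?thesis using density_mass_pos by auto
  next
    case 3
    define A where "A = {x. cumul x \<le> t}"
    obtain z where z: "t < cumul z" using 3 by blast
    have bdd: "bdd_above A"
    proof (rule bdd_aboveI)
      show "y \<le> z" if "y \<in> A" for y
        using that z cumul_mono[of z y] unfolding A_def mem_Collect_eq by linarith
    qed
    have "closed A"
      unfolding A_def by (intro closed_Collect_le cumul_continuous continuous_intros)
    then have s: "Sup A \<in> A" using 3 bdd by (intro closed_contains_Sup) (auto simp: A_def)
    have above: "t < cumul y" if "Sup A < y" for y
    proof (rule ccontr)
      assume "\<not> t < cumul y"
      then have "y \<in> A" by (simp add: A_def)
      then show False using cSup_upper[OF _ bdd, of y] that by simp
    qed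
    have set_eq: "{x. t < cumul x} = - {..Sup A}"
    proof (rule set_eqI)
      fix x
      show "x \<in> {x. t < cumul x} \<longleftrightarrow> x \<in> - {..Sup A}"
        using above[of x] s cumul_mono[of x "Sup A"] by (cases "x \<le> Sup A") (auto simp: A_def)
    qed
    \<comment> \<open>The Lipschitz bound excludes a jump at \<open>Sup A\<close>, so the level t is
      attained there.\<close>
    have "t \<le> cumul (Sup A) + e" if "0 < e" for e
      using above[of "Sup A + e"] cumul_increment(2)[of "Sup A" "Sup A + e"] that by simp
    then have "t \<le> cumul (Sup A)" by (rule field_le_epsilon)
    then have t: "cumul (Sup A) = t" using s by (simp add: A_def)
    have "(\<integral>x. \<rho> x * indicator {x. t < cumul x} x \<partial>lebesgue) =
        (\<integral>x. \<rho> x - \<rho> x * indicator {..Sup A} x \<partial>lebesgue)"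
      unfolding set_eq by (rule Bochner_Integration.integral_cong) (auto simp: indicator_def)
    also have "\<dots> = ?m - t"
      unfolding t[symmetric] cumul_def
      by (rule Bochner_Integration.integral_diff[OF density_integrable integrable_density_indicator]) simp
    finally show ?thesis using cumul_bounds[of "Sup A"] t by auto
  qed
qed

text \<open>The image measure of \<rho> dx under \<open>cumul\<close> is Lebesgue measure on [0, m],
  since both are finite on the rays {t<..} and agree there. Working with image measures avoids a
  change of variables along \<open>cumul\<close>, which is flat where \<rho> vanishes.\<close>

lemma integral_compose_cumul:
  fixes h H :: "real \<Rightarrow> real"
  assumes H: "\<And>t. (H has_real_derivative h t) (at t)" and cont: "continuous_on UNIV h"
  shows "(\<integral>x. \<rho> x * h (cumul x) \<partial>lebesgue) = H (integral\<^sup>L lebesgue \<rho>) - H 0"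
proof -
  let ?m = "integral\<^sup>L lebesgue \<rho>"
  note m = density_mass_pos
  have meas [measurable]: "h \<in> borel_measurable borel" using cont by (rule borel_measurable_continuous_onI)
  have [measurable]: "cumul \<in> lebesgue \<rightarrow>\<^sub>M borel"
    by (simp add: measurable_completion)
  let ?D = "distr (density lebesgue \<rho>) borel cumul"
  let ?U = "density lborel (indicator {0..?m} :: real \<Rightarrow> real)"
  have D: "emeasure ?D {t<..} = ennreal (if t < 0 then ?m else max 0 (?m - t))" for t
  proof -
    have [measurable]: "{x. t < cumul x} \<in> sets lebesgue"
      using measurable_sets[of cumul lebesgue borel "{t<..}"] by (simp add: vimage_def)
    have "emeasure ?D {t<..} = emeasure (density lebesgue \<rho>) {x. t < cumul x}"
      by (subst emeasure_distr) (auto simp: vimage_def)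
    also have "\<dots> = (\<integral>\<^sup>+x. ennreal (\<rho> x * indicator {x. t < cumul x} x) \<partial>lebesgue)"
      by (subst emeasure_density) (auto intro!: nn_integral_cong simp: indicator_def)
    also have "\<dots> = ennreal (\<integral>x. \<rho> x * indicator {x. t < cumul x} x \<partial>lebesgue)"
      by (rule nn_integral_eq_integral) (auto simp: integrable_density_indicator density_nonneg)
    finally show ?thesis unfolding integral_cumul_greater .
  qed
  have U: "emeasure ?U {t<..} = ennreal (if t < 0 then ?m else max 0 (?m - t))" for t
  proof -
    have "emeasure ?U {t<..} = emeasure lborel ({0..?m} \<inter> {t<..})"
      by (subst emeasure_density) (auto simp: ennreal_indicator indicator_inter_arith[symmetric])
    also have "{0..?m} \<inter> {t<..} = (if t < 0 then {0..?m} else if t \<le> ?m then {t<..?m} else {})"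
      by auto
    finally show ?thesis using m by (auto simp: max_def)
  qed
  have eq: "?D = ?U"
  proof (rule measure_eqI_lessThan)
    show "emeasure ?D {t<..} = emeasure ?U {t<..}" for t unfolding D U ..
    show "emeasure ?D {t<..} < \<infinity>" for t unfolding D by simp
  qed simp_all
  have "(\<integral>x. \<rho> x * h (cumul x) \<partial>lebesgue) = (\<integral>t. h t \<partial>?D)"
    by (subst integral_distr, measurable, subst integral_density) (auto simp: density_nonneg)
  also have "\<dots> = (\<integral>t. h t \<partial>?U)" unfolding eq ..
  also have "\<dots> = (\<integral>t. indicator {0..?m} t *\<^sub>R h t \<partial>lborel)"
    by (subst integral_density) auto
  also have "\<dots> = H ?m - H 0"
    by (rule integral_FTC_atLeastAtMost)
       (use m cont H in \<open>auto simp flip: has_real_derivative_iff_has_vector_derivative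
          intro: has_field_derivative_at_within continuous_on_subset\<close>)
  finally show ?thesis .
qed

end

section \<open>Upper bound\<close>

text \<open>Young's inequality. The term with the large factor 1 + 1 / \<delta> will be the one from
  the cutoff, of size \<delta>^2 for \<delta> equal to the reciprocal of the cutoff radius.\<close>

lemma diff_square_le_weighted:
  fixes a b \<delta> :: real
  assumes "0 < \<delta>"
  shows "(a - b)\<^sup>2 \<le> (1 + 1 / \<delta>) * a\<^sup>2 + (1 + \<delta>) * b\<^sup>2"
proof -
  have "0 \<le> (a + \<delta> * b)\<^sup>2 / \<delta>" using assms by simp
  also have "\<dots> = (1 + 1 / \<delta>) * a\<^sup>2 + (1 + \<delta>) * b\<^sup>2 - (a - b)\<^sup>2"
    using assms by (simp add: power2_eq_square field_simps)
  finally show ?thesis by simp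
qed

context
  fixes \<rho> :: "real \<Rightarrow> real"
  assumes \<rho>: "\<rho> \<in> densities"
begin

text \<open>For nonzero p the antiderivative is a multiple of sin(pi p t / m), which vanishes at 0
  and m. The index is an integer because differences i - j will be inserted.\<close>

lemma integral_cos_cumul:
  defines "m \<equiv> integral\<^sup>L lebesgue \<rho>"
  shows "(\<integral>x. \<rho> x * cos (pi * of_int p / m * cumul \<rho> x) \<partial>lebesgue) = (if p = 0 then m else 0)"
proof (cases "p = 0")
  case False
  define a where "a = pi * of_int p / m"
  have m: "0 < m" unfolding m_def by (rule density_mass_pos[OF \<rho>])
  have a: "a \<noteq> 0" using False m by (simp add: a_def)
  have "((\<lambda>t. sin (a * t) / a) has_real_derivative cos (a * t)) (at t)" for t
    using a by (auto intro!: derivative_eq_intros)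
  moreover have "continuous_on UNIV (\<lambda>t. cos (a * t))" by (intro continuous_intros)
  ultimately have "(\<integral>x. \<rho> x * cos (a * cumul \<rho> x) \<partial>lebesgue) = sin (a * m) / a - sin (a * 0) / a"
    unfolding m_def by (rule integral_compose_cumul[OF \<rho>])
  also have "a * m = pi * of_int p" using m by (simp add: a_def)
  finally show ?thesis using False by (simp add: a_def sin_int_times_real)
qed (simp add: m_def)

text \<open>Orthogonality of the Neumann eigenfunctions and of their derivatives, by the
  product-to-sum formulas. For i = j = 0 the sum and the difference of the indices both vanish,
  which doubles the norm of the constant function.\<close>

lemma
  fixes i j :: nat
  defines "m \<equiv> integral\<^sup>L lebesgue \<rho>"
  defines "\<omega> \<equiv> \<lambda>i :: nat. pi * real i / m"
  shows integral_cos_cos_cumul: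
      "(\<integral>x. \<rho> x * (cos (\<omega> i * cumul \<rho> x) * cos (\<omega> j * cumul \<rho> x)) \<partial>lebesgue) =
        (if i = j then if i = 0 then m else m / 2 else 0)"
    and integral_sin_sin_cumul:
      "(\<integral>x. \<rho> x * (\<omega> i * sin (\<omega> i * cumul \<rho> x) * (\<omega> j * sin (\<omega> j * cumul \<rho> x))) \<partial>lebesgue) =
        (if i = j then (\<omega> i)\<^sup>2 * (m / 2) else 0)"
proof -
  have m: "0 < m" unfolding m_def by (rule density_mass_pos[OF \<rho>])
  define c where "c p x = cos (pi * of_int p / m * cumul \<rho> x)" for p x
  have int: "integrable lebesgue (\<lambda>x. \<rho> x * c p x)" for p
    unfolding c_def
    by (rule integrable_density_bounded[OF \<rho>, of _ 1])
       (use m in \<open>auto intro!: continuous_measurable_lebesgue continuous_intros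
         cumul_continuous[OF \<rho>]\<close>)
  have c: "(\<integral>x. \<rho> x * c p x \<partial>lebesgue) = (if p = 0 then m else 0)" for p
    unfolding c_def m_def by (rule integral_cos_cumul)
  have diff: "\<omega> i * cumul \<rho> x - \<omega> j * cumul \<rho> x = pi * of_int (int i - int j) / m * cumul \<rho> x"
    and plus: "\<omega> i * cumul \<rho> x + \<omega> j * cumul \<rho> x = pi * of_int (int i + int j) / m * cumul \<rho> x" for x
    using m by (simp_all add: \<omega>_def algebra_simps diff_divide_distrib add_divide_distrib)
  have "(\<integral>x. \<rho> x * (cos (\<omega> i * cumul \<rho> x) * cos (\<omega> j * cumul \<rho> x)) \<partial>lebesgue) =
      (\<integral>x. \<rho> x * c (int i - int j) x / 2 + \<rho> x * c (int i + int j) x / 2 \<partial>lebesgue)"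
    unfolding cos_times_cos diff plus c_def[symmetric]
    by (rule Bochner_Integration.integral_cong) (simp_all add: field_simps)
  also have "\<dots> = (if int i - int j = 0 then m else 0) / 2 + (if int i + int j = 0 then m else 0) / 2"
    using int by (subst Bochner_Integration.integral_add) (simp_all add: c del: of_nat_add)
  finally show "(\<integral>x. \<rho> x * (cos (\<omega> i * cumul \<rho> x) * cos (\<omega> j * cumul \<rho> x)) \<partial>lebesgue) =
      (if i = j then if i = 0 then m else m / 2 else 0)"
    by (auto split: if_splits)
  have "(\<integral>x. \<rho> x * (\<omega> i * sin (\<omega> i * cumul \<rho> x) * (\<omega> j * sin (\<omega> j * cumul \<rho> x))) \<partial>lebesgue) =
      (\<integral>x. \<omega> i * \<omega> j / 2 * (\<rho> x * (2 * (sin (\<omega> i * cumul \<rho> x) * sin (\<omega> j * cumul \<rho> x)))) \<partial>lebesgue)"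
    by (rule Bochner_Integration.integral_cong) (simp_all add: field_simps)
  also have "\<dots> = (\<integral>x. \<omega> i * \<omega> j / 2 * (\<rho> x * c (int i - int j) x - \<rho> x * c (int i + int j) x) \<partial>lebesgue)"
    unfolding sin_times_sin diff plus c_def[symmetric]
    by (rule Bochner_Integration.integral_cong) (simp_all add: field_simps)
  also have "\<dots> = \<omega> i * \<omega> j / 2 * ((if int i - int j = 0 then m else 0) - (if int i + int j = 0 then m else 0))"
    unfolding integral_mult_right_zero
    using int by (subst Bochner_Integration.integral_diff) (simp_all add: c del: of_nat_add)
  also have "\<dots> = (if i = j then (\<omega> i)\<^sup>2 * (m / 2) else 0)"
    by (auto simp: power2_eq_square \<omega>_def)
  finally show "(\<integral>x. \<rho> x * (\<omega> i * sin (\<omega> i * cumul \<rho> x) * (\<omega> j * sin (\<omega> j * cumul \<rho> x))) \<partial>lebesgue) =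
      (if i = j then (\<omega> i)\<^sup>2 * (m / 2) else 0)" .
qed

lemma
  fixes f :: "nat \<Rightarrow> real \<Rightarrow> real"
  assumes meas: "\<And>i. f i \<in> borel_measurable lebesgue" and bound: "\<And>i x. \<bar>f i x\<bar> \<le> M i"
  shows integrable_density_quadratic: "integrable lebesgue (\<lambda>x. \<rho> x * (\<Sum>i\<le>k. c i * f i x)\<^sup>2)"
    and integral_density_quadratic: "(\<integral>x. \<rho> x * (\<Sum>i\<le>k. c i * f i x)\<^sup>2 \<partial>lebesgue) =
      (\<Sum>i\<le>k. \<Sum>j\<le>k. c i * c j * (\<integral>x. \<rho> x * (f i x * f j x) \<partial>lebesgue))"
proof -
  have int: "integrable lebesgue (\<lambda>x. \<rho> x * (f i x * f j x))" for i j
  proof (rule integrable_density_bounded[OF \<rho>])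
    show "(\<lambda>x. f i x * f j x) \<in> borel_measurable lebesgue" using meas by simp
    have "0 \<le> M i" using bound[of i 0] by linarith
    then show "\<bar>f i x * f j x\<bar> \<le> M i * M j" for x
      unfolding abs_mult by (intro mult_mono bound) auto
  qed
  have eq: "\<rho> x * (\<Sum>i\<le>k. c i * f i x)\<^sup>2 = (\<Sum>i\<le>k. \<Sum>j\<le>k. c i * c j * (\<rho> x * (f i x * f j x)))" for x
    by (simp only: power2_eq_square sum_product) (simp add: sum_distrib_left mult_ac)
  show "integrable lebesgue (\<lambda>x. \<rho> x * (\<Sum>i\<le>k. c i * f i x)\<^sup>2)"
    unfolding eq using int by (intro Bochner_Integration.integrable_sum integrable_mult_right)
  show "(\<integral>x. \<rho> x * (\<Sum>i\<le>k. c i * f i x)\<^sup>2 \<partial>lebesgue) =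
      (\<Sum>i\<le>k. \<Sum>j\<le>k. c i * c j * (\<integral>x. \<rho> x * (f i x * f j x) \<partial>lebesgue))"
    unfolding eq using int by (simp add: Bochner_Integration.integral_sum)
qed

lemma tendsto_density_gram:
  fixes f :: "nat \<Rightarrow> nat \<Rightarrow> real \<Rightarrow> real"
  assumes "\<And>n i. f n i \<in> borel_measurable lebesgue" and g: "\<And>i. g i \<in> borel_measurable lebesgue"
    and bound: "\<And>n i x. \<bar>f n i x\<bar> \<le> M i" and lim: "\<And>i x. (\<lambda>n. f n i x) \<longlonglongrightarrow> g i x"
  shows "(\<lambda>n. \<integral>x. \<rho> x * (f n i x * f n j x) \<partial>lebesgue) \<longlonglongrightarrow> (\<integral>x. \<rho> x * (g i x * g j x) \<partial>lebesgue)"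
proof (rule tendsto_integral_density[OF \<rho>])
  have "0 \<le> M i" using bound[of 0 i 0] by linarith
  then show "\<bar>f n i x * f n j x\<bar> \<le> M i * M j" for n x
    unfolding abs_mult by (intro mult_mono bound) auto
  show "(\<lambda>n. f n i x * f n j x) \<longlonglongrightarrow> g i x * g j x" for x by (intro tendsto_mult lim)
qed (use assms in simp_all)

text \<open>Positivity of the form does double duty: it makes the classes of the \<open>X i\<close>
  linearly independent, so that their span has dimension k + 1, and it allows division in the
  quotient.\<close>

lemma mu_le_trial:
  assumes test: "\<And>i. i \<le> k \<Longrightarrow> X i \<in> test_functions"
    and pos: "\<And>c. \<exists>i\<le>k. c i \<noteq> 0 \<Longrightarrow> 0 < (\<integral>x. \<rho> x * (\<Sum>i\<le>k. c i * X i x)\<^sup>2 \<partial>lebesgue)"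
    and le: "\<And>c. \<exists>i\<le>k. c i \<noteq> 0 \<Longrightarrow>
      (\<integral>x. \<rho> x * (deriv (\<lambda>x. \<Sum>i\<le>k. c i * X i x) x)\<^sup>2 \<partial>lebesgue) \<le>
      \<Lambda> * (\<integral>x. \<rho> x * (\<Sum>i\<le>k. c i * X i x)\<^sup>2 \<partial>lebesgue)"
  shows "mu k \<rho> \<le> ereal \<Lambda>"
proof -
  define b where "b i = restr \<rho> (X i)" for i
  have v_test: "(\<lambda>x. \<Sum>i\<le>k. c i * X i x) \<in> test_functions" for c
    by (rule test_functions_sum) (use test in auto)
  have restr_v: "restr \<rho> (\<lambda>x. \<Sum>i\<le>k. c i * X i x) = (\<Sum>i\<le>k. c i *\<^sub>R b i)" for c
    unfolding b_def by (rule restr_sum)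
  have indep: "c i = 0" if "(\<Sum>i\<le>k. c i *\<^sub>R b i) = 0" "i \<le> k" for c i
  proof (rule ccontr)
    assume "c i \<noteq> 0"
    then have "0 < (\<integral>x. \<rho> x * (\<Sum>i\<le>k. c i * X i x)\<^sup>2 \<partial>lebesgue)" using that by (intro pos) blast
    moreover have "AE x in lebesgue. \<rho> x * (\<Sum>i\<le>k. c i * X i x)\<^sup>2 = 0"
      using that(1) unfolding restr_v[symmetric] restr_eq_zero_iff[OF density_nonneg[OF \<rho>]] .
    then have "(\<integral>x. \<rho> x * (\<Sum>i\<le>k. c i * X i x)\<^sup>2 \<partial>lebesgue) = 0"
      by (rule integral_eq_zero_AE)
    ultimately show False by simp
  qed
  have inj: "inj_on b {..k}"
  proof (rule inj_onI, rule ccontr)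
    fix i j assume ij: "i \<in> {..k}" "j \<in> {..k}" "b i = b j" "i \<noteq> j"
    \<comment> \<open>Two equal classes would give the vanishing combination b i - b j.\<close>
    define c where "c l = (if l = i then 1 else if l = j then - 1 else 0 :: real)" for l
    have "(\<Sum>l\<le>k. c l *\<^sub>R b l) = (\<Sum>l\<in>{i, j}. c l *\<^sub>R b l)"
      by (rule sum.mono_neutral_right) (use ij in \<open>auto simp: c_def\<close>)
    also have "\<dots> = 0" using ij by (simp add: c_def)
    finally have "c i = 0" using ij by (intro indep) auto
    then show False by (simp add: c_def)
  qed
  have "independent (b ` {..k})"
  proof (rule independent_if_scalars_zero)
    fix f x assume "(\<Sum>y\<in>b ` {..k}. f y *\<^sub>R y) = 0" "x \<in> b ` {..k}"
    then show "f x = 0" using indep[of "\<lambda>i. f (b i)"] by (auto simp: sum.reindex[OF inj])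
  qed simp
  then have dim: "dim (span (b ` {..k})) = k + 1"
    by (simp add: dim_eq_card_independent card_image[OF inj])
  have span: "\<exists>c. s = restr \<rho> (\<lambda>x. \<Sum>i\<le>k. c i * X i x)" if "s \<in> span (b ` {..k})" for s
  proof -
    obtain u where "s = (\<Sum>y\<in>b ` {..k}. u y *\<^sub>R y)"
      using \<open>s \<in> span (b ` {..k})\<close> span_finite[of "b ` {..k}"] by auto
    then have "s = (\<Sum>i\<le>k. u (b i) *\<^sub>R b i)" by (simp add: sum.reindex[OF inj])
    then show ?thesis unfolding restr_v by (rule exI[of _ "\<lambda>i. u (b i)"])
  qed
  show ?thesis
    unfolding mu_def
  proof (rule INF_lower2)
    show "span (b ` {..k}) \<in> trial_subspaces (k + 1) \<rho>"
    proof -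
      have "span (b ` {..k}) \<subseteq> trial_space \<rho>"
      proof
        fix s assume "s \<in> span (b ` {..k})"
        then obtain c where "s = restr \<rho> (\<lambda>x. \<Sum>i\<le>k. c i * X i x)" using span[of s] by auto
        then show "s \<in> trial_space \<rho>" unfolding trial_space_def by (rule image_eqI[OF _ v_test])
      qed
      then show ?thesis using dim by (simp add: trial_subspaces_def)
    qed
    show "(SUP u\<in>{u \<in> test_functions. restr \<rho> u \<in> span (b ` {..k}) - {0}}. ereal (rayleigh \<rho> u)) \<le> ereal \<Lambda>"
    proof (rule SUP_least)
      fix u assume u: "u \<in> {u \<in> test_functions. restr \<rho> u \<in> span (b ` {..k}) - {0}}"
      then obtain c where c: "restr \<rho> u = restr \<rho> (\<lambda>x. \<Sum>i\<le>k. c i * X i x)"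
        using span[of "restr \<rho> u"] by auto
      have nz: "\<exists>i\<le>k. c i \<noteq> 0"
      proof (rule ccontr)
        assume "\<not> ?thesis"
        then have "restr \<rho> u = 0" unfolding c restr_v by simp
        then show False using u by simp
      qed
      \<comment> \<open>The supremum runs over every test function with class in the span, so
        \<open>u\<close> need not itself be a combination of the \<open>X i\<close>.\<close>
      have "rayleigh \<rho> u = rayleigh \<rho> (\<lambda>x. \<Sum>i\<le>k. c i * X i x)"
        by (rule rayleigh_cong[OF \<rho> _ v_test c]) (use u in simp)
      also have "\<dots> \<le> \<Lambda>"
        unfolding rayleigh_def using pos[OF nz] le[OF nz] by (simp add: pos_divide_le_eq)
      finally show "ereal (rayleigh \<rho> u) \<le> ereal \<Lambda>" by simp
    qed
  qed
qed

text \<open>The trial functions are \<open>cos (\<pi> i F / m)\<close>, \<open>i \<le> k\<close>, with \<open>F\<close> replaced by a smooth \<open>G\<close> satisfying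
  \<open>\<bar>G'\<bar> \<le> 1 + e\<close> and multiplied by a wide cutoff. The bound on the derivatives needs no convergence
  of \<open>G'\<close>.\<close>

lemma mu_le_aux:
  assumes "0 < \<epsilon>"
  shows "mu k \<rho> \<le> ereal ((pi * real k / integral\<^sup>L lebesgue \<rho>)\<^sup>2 + \<epsilon>)"
proof -
  define m where "m = integral\<^sup>L lebesgue \<rho>"
  have m: "0 < m" unfolding m_def by (rule density_mass_pos[OF \<rho>])
  define \<omega> where "\<omega> i = pi * real i / m" for i
  obtain \<psi> K where \<psi>: "smooth \<psi>" "\<psi> 0 = 1" "\<And>x. 0 \<le> \<psi> x \<and> \<psi> x \<le> 1"
    "\<And>x. 1 \<le> \<bar>x\<bar> \<Longrightarrow> \<psi> x = 0" "\<And>x. 1 < \<bar>x\<bar> \<Longrightarrow> deriv \<psi> x = 0" "\<And>x. \<bar>deriv \<psi> x\<bar> \<le> K"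
    using smooth_bump by metis
  \<comment> \<open>One parameter plays three roles: tolerance of the approximation
    \<open>G n\<close>, reciprocal of the cutoff radius n + 1, and weight in Young's
    inequality.\<close>
  define e where "e n = inverse (real (Suc n))" for n
  have e: "0 < e n" "e \<longlonglongrightarrow> 0" for n
    unfolding e_def[abs_def] by (simp, rule LIMSEQ_inverse_real_of_nat)
  have "\<exists>G. smooth G \<and> (\<forall>x. \<bar>x\<bar> \<le> real (Suc n) \<longrightarrow> \<bar>deriv G x\<bar> \<le> 1 + e n) \<and>
      (\<forall>x. \<bar>x\<bar> \<le> real (Suc n) \<longrightarrow> \<bar>G x - cumul \<rho> x\<bar> \<le> e n)" for n
    using smooth_approx_Lipschitz[OF cumul_Lipschitz[OF \<rho>] e(1)[of n], of "real (Suc n)"]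
    by (metis of_nat_0_less_iff zero_less_Suc)
  then obtain G where G: "\<And>n. smooth (G n)"
    "\<And>n x. \<bar>x\<bar> \<le> real (Suc n) \<Longrightarrow> \<bar>deriv (G n) x\<bar> \<le> 1 + e n"
    "\<And>n x. \<bar>x\<bar> \<le> real (Suc n) \<Longrightarrow> \<bar>G n x - cumul \<rho> x\<bar> \<le> e n"
    by metis
  define X where "X n i x = \<psi> (e n * x) * cos (\<omega> i * G n x)" for n i x
  \<comment> \<open>Differentiating \<open>X n i\<close> gives two terms. \<open>Y\<close> is, up to
    sign, the cofactor of the derivative of \<open>G n\<close>; within the cutoff radius
    \<open>Z\<close> is the cofactor of the derivative of the cutoff.\<close>
  define Y where "Y n i x = \<psi> (e n * x) * (\<omega> i * sin (\<omega> i * G n x))" for n i x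
  define Z where "Z n i x = indicator {- real (Suc n)..real (Suc n)} x * cos (\<omega> i * G n x)" for n i x
  have outside: "1 < \<bar>e n * x\<bar>" if "\<not> \<bar>x\<bar> \<le> real (Suc n)" for n x
    using that by (simp add: e_def abs_mult divide_simps del: of_nat_Suc)
  have smooth_cut: "smooth (\<lambda>x. \<psi> (e n * x))" for n
    by (rule smooth_compose[OF \<psi>(1) smooth_mult[OF smooth_const smooth_ident]])
  have smooth_cos_G: "smooth (\<lambda>x. cos (\<omega> i * G n x))" for i n
    by (rule smooth_compose[OF smooth_cos smooth_mult[OF smooth_const G(1)]])
  have cont_G: "continuous_on A (G n)" for A n by (rule smooth_continuous_on[OF G(1)])
  have smooth_X: "smooth (X n i)" for n i
    unfolding X_def[abs_def] by (rule smooth_mult[OF smooth_cut smooth_cos_G])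
  have test_X: "X n i \<in> test_functions" for n i
  proof -
    have "{x. X n i x \<noteq> 0} \<subseteq> {- real (Suc n)..real (Suc n)}"
    proof
      fix x assume "x \<in> {x. X n i x \<noteq> 0}"
      then have "\<psi> (e n * x) \<noteq> 0" by (auto simp: X_def)
      then have "\<bar>x\<bar> \<le> real (Suc n)" using outside[of x n] \<psi>(4)[of "e n * x"] by fastforce
      then show "x \<in> {- real (Suc n)..real (Suc n)}" by auto
    qed
    then have "bounded {x. X n i x \<noteq> 0}" by (rule bounded_subset[rotated]) simp
    then show ?thesis by (simp add: test_functions_iff smooth_X)
  qed
  have meas_X: "X n i \<in> borel_measurable lebesgue" for n i
    by (rule smooth_measurable[OF smooth_X])
  have meas_Y: "Y n i \<in> borel_measurable lebesgue" for n i
    unfolding Y_def[abs_def]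
    by (intro continuous_measurable_lebesgue continuous_on_mult
        continuous_on_const continuous_on_sin cont_G smooth_continuous_on[OF smooth_cut])
  have meas_Z: "Z n i \<in> borel_measurable lebesgue" for n i
    unfolding Z_def[abs_def]
    by (intro borel_measurable_times smooth_measurable[OF smooth_cos_G] borel_measurable_indicator) simp
  have bound_X: "\<bar>X n i x\<bar> \<le> 1" for n i x
    unfolding X_def abs_mult using \<psi>(3)[of "e n * x"] by (intro mult_le_one) auto
  have bound_Y: "\<bar>Y n i x\<bar> \<le> \<bar>\<omega> i\<bar>" for n i x
  proof -
    have "\<bar>\<psi> (e n * x)\<bar> * \<bar>\<omega> i * sin (\<omega> i * G n x)\<bar> \<le> 1 * (\<bar>\<omega> i\<bar> * 1)"
      unfolding abs_mult using \<psi>(3)[of "e n * x"] by (intro mult_mono) auto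
    then show ?thesis by (simp add: Y_def abs_mult)
  qed
  have bound_Z: "\<bar>Z n i x\<bar> \<le> 1" for n i x
    by (simp add: Z_def indicator_def)
  have lim_G: "(\<lambda>n. G n x) \<longlonglongrightarrow> cumul \<rho> x" for x
  proof (rule Lim_null_comparison[THEN LIM_zero_cancel])
    have "\<forall>\<^sub>F n in sequentially. \<bar>x\<bar> < real n"
      using filterlim_real_sequentially unfolding filterlim_at_top_dense by blast
    then show "\<forall>\<^sub>F n in sequentially. norm (G n x - cumul \<rho> x) \<le> e n"
      by eventually_elim (auto intro!: G(3))
  qed (rule e)
  have lim_cut: "(\<lambda>n. \<psi> (e n * x)) \<longlonglongrightarrow> 1" for x
  proof -
    have "(\<lambda>n. \<psi> (e n * x)) \<longlonglongrightarrow> \<psi> (0 * x)"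
      by (rule isCont_tendsto_compose[OF DERIV_isCont[OF smooth_DERIV[OF \<psi>(1)]]])
         (intro tendsto_intros e)
    then show ?thesis by (simp add: \<psi>(2))
  qed
  have lim_X: "(\<lambda>n. X n i x) \<longlonglongrightarrow> cos (\<omega> i * cumul \<rho> x)" for i x
    using tendsto_mult[OF lim_cut tendsto_cos[OF tendsto_mult_left[OF lim_G]]]
    unfolding X_def by simp
  have lim_Y: "(\<lambda>n. Y n i x) \<longlonglongrightarrow> \<omega> i * sin (\<omega> i * cumul \<rho> x)" for i x
    using tendsto_mult[OF lim_cut tendsto_mult_left[OF tendsto_sin[OF tendsto_mult_left[OF lim_G]]]]
    unfolding Y_def by simp
  have lim_Z: "(\<lambda>n. Z n i x) \<longlonglongrightarrow> cos (\<omega> i * cumul \<rho> x)" for i x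
  proof -
    have "\<forall>\<^sub>F n in sequentially. \<bar>x\<bar> < real n"
      using filterlim_real_sequentially unfolding filterlim_at_top_dense by blast
    then have "(\<lambda>n. indicator {- real (Suc n)..real (Suc n)} x) \<longlonglongrightarrow> (1 :: real)"
      by (intro tendsto_eventually) (auto elim!: eventually_mono simp: indicator_def)
    from tendsto_mult[OF this tendsto_cos[OF tendsto_mult_left[OF lim_G]]]
    show ?thesis unfolding Z_def by simp
  qed
  define A where "A n i j = (\<integral>x. \<rho> x * (X n i x * X n j x) \<partial>lebesgue)" for n i j
  define B where "B n i j = (\<integral>x. \<rho> x * (Y n i x * Y n j x) \<partial>lebesgue)" for n i j
  define C where "C n i j = (\<integral>x. \<rho> x * (Z n i x * Z n j x) \<partial>lebesgue)" for n i j
  have meas_cos: "(\<lambda>x. cos (\<omega> i * cumul \<rho> x)) \<in> borel_measurable lebesgue"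
    and meas_sin: "(\<lambda>x. \<omega> i * sin (\<omega> i * cumul \<rho> x)) \<in> borel_measurable lebesgue" for i
    by (intro continuous_measurable_lebesgue continuous_intros
        cumul_continuous[OF \<rho>])+
  define \<alpha> where "\<alpha> i = (if i = 0 then m else m / 2)" for i :: nat
  have lim_A: "(\<lambda>n. A n i j) \<longlonglongrightarrow> (if i = j then \<alpha> i else 0)" for i j
    using tendsto_density_gram[OF meas_X meas_cos bound_X lim_X, where i = i and j = j]
    unfolding A_def \<omega>_def m_def integral_cos_cos_cumul \<alpha>_def .
  have lim_B: "(\<lambda>n. B n i j) \<longlonglongrightarrow> (if i = j then (\<omega> i)\<^sup>2 * (m / 2) else 0)" for i j
    using tendsto_density_gram[OF meas_Y meas_sin bound_Y lim_Y, where i = i and j = j]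
    unfolding B_def \<omega>_def m_def integral_sin_sin_cumul .
  have lim_C: "(\<lambda>n. C n i j) \<longlonglongrightarrow> (if i = j then \<alpha> i else 0)" for i j
    using tendsto_density_gram[OF meas_Z meas_cos bound_Z lim_Z, where i = i and j = j]
    unfolding C_def \<omega>_def m_def integral_cos_cos_cumul \<alpha>_def .
  define \<Lambda> where "\<Lambda> = (\<omega> k)\<^sup>2 + \<epsilon>"
  \<comment> \<open>Matrix of \<Lambda> times the denominator minus the bound for the numerator. Its
    limit is diagonal, and the slack \<epsilon> in \<Lambda> makes the diagonal positive.\<close>
  define D where "D n i j = \<Lambda> * A n i j - ((1 + e n) ^ 3 * B n i j + ((e n)\<^sup>2 + e n) * K\<^sup>2 * C n i j)"
    for n i j
  have "\<forall>\<^sub>F n in sequentially. \<forall>c. (\<exists>i\<le>k. c i \<noteq> 0) \<longrightarrow> 0 < (\<Sum>i\<le>k. \<Sum>j\<le>k. c i * c j * A n i j)"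
    by (rule eventually_positive_definite[OF lim_A]) (use m in \<open>simp add: \<alpha>_def\<close>)
  moreover have "\<forall>\<^sub>F n in sequentially. \<forall>c. (\<exists>i\<le>k. c i \<noteq> 0) \<longrightarrow>
      0 < (\<Sum>i\<le>k. \<Sum>j\<le>k. c i * c j * D n i j)"
  proof (rule eventually_positive_definite)
    fix i j
    have "(\<lambda>n. D n i j) \<longlonglongrightarrow> \<Lambda> * (if i = j then \<alpha> i else 0) -
        ((1 + 0) ^ 3 * (if i = j then (\<omega> i)\<^sup>2 * (m / 2) else 0) +
         (0\<^sup>2 + 0) * K\<^sup>2 * (if i = j then \<alpha> i else 0))"
      unfolding D_def by (intro tendsto_intros e lim_A lim_B lim_C)
    then show "(\<lambda>n. D n i j) \<longlonglongrightarrow> (if i = j then \<Lambda> * \<alpha> i - (\<omega> i)\<^sup>2 * (m / 2) else 0)"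
      by (simp split: if_splits)
  next
    fix i assume "i \<le> k"
    then have "(\<omega> i)\<^sup>2 \<le> (\<omega> k)\<^sup>2"
      unfolding \<omega>_def using m by (intro power_mono divide_right_mono mult_left_mono) auto
    then have "(\<omega> i)\<^sup>2 < \<Lambda>" using \<open>0 < \<epsilon>\<close> by (simp add: \<Lambda>_def)
    then have "(\<omega> i)\<^sup>2 * (m / 2) < \<Lambda> * (m / 2)" using m by (intro mult_strict_right_mono) auto
    also have "\<dots> \<le> \<Lambda> * \<alpha> i"
      using m \<open>0 < \<epsilon>\<close> by (intro mult_left_mono) (auto simp: \<alpha>_def \<Lambda>_def)
    finally show "0 < \<Lambda> * \<alpha> i - (\<omega> i)\<^sup>2 * (m / 2)" by simp
  qed
  ultimately have "\<forall>\<^sub>F n in sequentially. \<forall>c. (\<exists>i\<le>k. c i \<noteq> 0) \<longrightarrow>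
      0 < (\<Sum>i\<le>k. \<Sum>j\<le>k. c i * c j * A n i j) \<and> 0 < (\<Sum>i\<le>k. \<Sum>j\<le>k. c i * c j * D n i j)"
    by eventually_elim blast
  then obtain n where "\<forall>c. (\<exists>i\<le>k. c i \<noteq> 0) \<longrightarrow>
      0 < (\<Sum>i\<le>k. \<Sum>j\<le>k. c i * c j * A n i j) \<and> 0 < (\<Sum>i\<le>k. \<Sum>j\<le>k. c i * c j * D n i j)"
    unfolding eventually_sequentially by (meson order_refl)
  then have pos: "\<And>c. \<exists>i\<le>k. c i \<noteq> 0 \<Longrightarrow> 0 < (\<Sum>i\<le>k. \<Sum>j\<le>k. c i * c j * A n i j)"
      "\<And>c. \<exists>i\<le>k. c i \<noteq> 0 \<Longrightarrow> 0 < (\<Sum>i\<le>k. \<Sum>j\<le>k. c i * c j * D n i j)"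
    by blast+
  have den: "(\<integral>x. \<rho> x * (\<Sum>i\<le>k. c i * X n i x)\<^sup>2 \<partial>lebesgue) = (\<Sum>i\<le>k. \<Sum>j\<le>k. c i * c j * A n i j)" for c
    unfolding A_def by (rule integral_density_quadratic[OF meas_X bound_X])
  have pointwise: "(deriv (\<lambda>x. \<Sum>i\<le>k. c i * X n i x) x)\<^sup>2 \<le>
      (1 + e n) ^ 3 * (\<Sum>i\<le>k. c i * Y n i x)\<^sup>2 + ((e n)\<^sup>2 + e n) * K\<^sup>2 * (\<Sum>i\<le>k. c i * Z n i x)\<^sup>2"
    for c x
  proof -
    define p where "p = deriv \<psi> (e n * x) * e n"
    define g where "g = deriv (G n) x"
    define S where "S = (\<Sum>i\<le>k. c i * Y n i x)"
    define T where "T = (\<Sum>i\<le>k. c i * cos (\<omega> i * G n x))"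
    have "(X n i has_real_derivative p * cos (\<omega> i * G n x) - Y n i x * g) (at x)" for i
    proof -
      have "((\<lambda>x. \<psi> (e n * x)) has_real_derivative p) (at x)"
        unfolding p_def by (rule DERIV_chain2[OF smooth_DERIV[OF \<psi>(1)] DERIV_cmult_Id])
      moreover have "((\<lambda>x. cos (\<omega> i * G n x)) has_real_derivative - sin (\<omega> i * G n x) * (\<omega> i * g)) (at x)"
        unfolding g_def by (rule DERIV_chain2[OF DERIV_cos DERIV_cmult[OF smooth_DERIV[OF G(1)]]])
      ultimately have "(X n i has_real_derivative
          p * cos (\<omega> i * G n x) + - sin (\<omega> i * G n x) * (\<omega> i * g) * \<psi> (e n * x)) (at x)"
        unfolding X_def[abs_def] by (rule DERIV_mult)
      then show ?thesis by (rule DERIV_cong) (simp add: Y_def)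
    qed
    then have "((\<lambda>x. \<Sum>i\<le>k. c i * X n i x) has_real_derivative
        (\<Sum>i\<le>k. c i * (p * cos (\<omega> i * G n x) - Y n i x * g))) (at x)"
      by (intro DERIV_sum[OF DERIV_cmult])
    moreover have "(\<Sum>i\<le>k. c i * (p * cos (\<omega> i * G n x) - Y n i x * g)) = p * T - g * S"
      by (simp add: T_def S_def sum_distrib_left right_diff_distrib sum_subtractf mult_ac)
    ultimately have deriv: "deriv (\<lambda>x. \<Sum>i\<le>k. c i * X n i x) x = p * T - g * S"
      by (metis DERIV_imp_deriv)
    show ?thesis
    proof (cases "\<bar>x\<bar> \<le> real (Suc n)")
      case True
      then have Z: "(\<Sum>i\<le>k. c i * Z n i x) = T"
        unfolding T_def by (intro sum.cong) (auto simp: Z_def indicator_def)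
      have "p\<^sup>2 \<le> (K * e n)\<^sup>2"
      proof -
        have "\<bar>p\<bar> \<le> K * e n"
          unfolding p_def abs_mult using \<psi>(6)[of "e n * x"] e(1)[of n] by (simp add: mult_right_mono)
        from power_mono[OF this abs_ge_zero, of 2] show ?thesis by simp
      qed
      then have pT: "(p * T)\<^sup>2 \<le> (K * e n)\<^sup>2 * T\<^sup>2"
        unfolding power_mult_distrib by (intro mult_right_mono) auto
      have "g\<^sup>2 \<le> (1 + e n)\<^sup>2"
        using power_mono[OF G(2)[OF True] abs_ge_zero, of 2] by (simp add: g_def)
      then have gS: "(g * S)\<^sup>2 \<le> (1 + e n)\<^sup>2 * S\<^sup>2"
        unfolding power_mult_distrib by (intro mult_right_mono) auto
      have "(p * T - g * S)\<^sup>2 \<le> (1 + 1 / e n) * (p * T)\<^sup>2 + (1 + e n) * (g * S)\<^sup>2"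
        by (rule diff_square_le_weighted[OF e(1)])
      also have "\<dots> \<le> (1 + 1 / e n) * ((K * e n)\<^sup>2 * T\<^sup>2) + (1 + e n) * ((1 + e n)\<^sup>2 * S\<^sup>2)"
        using e(1)[of n] by (intro add_mono mult_left_mono pT gS) auto
      also have "(1 + 1 / e n) * ((K * e n)\<^sup>2 * T\<^sup>2) = ((e n)\<^sup>2 + e n) * K\<^sup>2 * T\<^sup>2"
      proof -
        have "(1 + 1 / e n) * (e n)\<^sup>2 = (e n)\<^sup>2 + e n"
          using e(1)[of n] by (simp add: power2_eq_square distrib_right)
        then show ?thesis by (metis power_mult_distrib mult.assoc mult.commute)
      qed
      also have "(1 + e n) * ((1 + e n)\<^sup>2 * S\<^sup>2) = (1 + e n) ^ 3 * S\<^sup>2"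
        by (simp add: power2_eq_square power3_eq_cube)
      also have "((e n)\<^sup>2 + e n) * K\<^sup>2 * T\<^sup>2 + (1 + e n) ^ 3 * S\<^sup>2 =
          (1 + e n) ^ 3 * S\<^sup>2 + ((e n)\<^sup>2 + e n) * K\<^sup>2 * T\<^sup>2" by (rule add.commute)
      finally show ?thesis unfolding deriv Z S_def[symmetric] .
    next
      \<comment> \<open>Nothing is known about \<open>G n\<close> beyond the radius, but there the
        cutoff and its derivative both vanish.\<close>
      case False
      have "p = 0" unfolding p_def using \<psi>(5)[OF outside[OF False]] by simp
      moreover have "S = 0"
        unfolding S_def Y_def using \<psi>(4)[OF less_imp_le[OF outside[OF False]]] by simp
      ultimately show ?thesis unfolding deriv using e(1)[of n] by (simp add: add_nonneg_nonneg)
    qed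
  qed
  have num: "(\<integral>x. \<rho> x * (deriv (\<lambda>x. \<Sum>i\<le>k. c i * X n i x) x)\<^sup>2 \<partial>lebesgue) \<le>
      (1 + e n) ^ 3 * (\<Sum>i\<le>k. \<Sum>j\<le>k. c i * c j * B n i j) +
      ((e n)\<^sup>2 + e n) * K\<^sup>2 * (\<Sum>i\<le>k. \<Sum>j\<le>k. c i * c j * C n i j)" for c
  proof -
    let ?Q = "\<lambda>x. (1 + e n) ^ 3 * (\<rho> x * (\<Sum>i\<le>k. c i * Y n i x)\<^sup>2) +
      ((e n)\<^sup>2 + e n) * K\<^sup>2 * (\<rho> x * (\<Sum>i\<le>k. c i * Z n i x)\<^sup>2)"
    note intY = integrable_density_quadratic[OF meas_Y bound_Y, where k = k and c = c]
    note intZ = integrable_density_quadratic[OF meas_Z bound_Z, where k = k and c = c]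
    have "(\<integral>x. \<rho> x * (deriv (\<lambda>x. \<Sum>i\<le>k. c i * X n i x) x)\<^sup>2 \<partial>lebesgue) \<le> (\<integral>x. ?Q x \<partial>lebesgue)"
    \<comment> \<open>Integrability is shown for the majorant alone: a non-integrable left side
      would have integral 0, below that of the nonnegative \<open>?Q\<close>.\<close>
    proof (rule integral_mono')
      show "integrable lebesgue ?Q"
        by (intro Bochner_Integration.integrable_add integrable_mult_right intY intZ)
      fix x
      show "\<rho> x * (deriv (\<lambda>x. \<Sum>i\<le>k. c i * X n i x) x)\<^sup>2 \<le> ?Q x"
        using mult_left_mono[OF pointwise[where c = c and x = x] density_nonneg[OF \<rho>, of x]] by (simp add: algebra_simps)
      show "0 \<le> ?Q x" using density_nonneg[OF \<rho>] e(1)[of n] by (simp add: add_nonneg_nonneg)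
    qed
    also have "\<dots> = (1 + e n) ^ 3 * (\<integral>x. \<rho> x * (\<Sum>i\<le>k. c i * Y n i x)\<^sup>2 \<partial>lebesgue) +
        ((e n)\<^sup>2 + e n) * K\<^sup>2 * (\<integral>x. \<rho> x * (\<Sum>i\<le>k. c i * Z n i x)\<^sup>2 \<partial>lebesgue)"
      using intY intZ by (subst Bochner_Integration.integral_add) simp_all
    finally show ?thesis
      unfolding integral_density_quadratic[OF meas_Y bound_Y] integral_density_quadratic[OF meas_Z bound_Z]
        B_def[symmetric] C_def[symmetric] .
  qed
  have "mu k \<rho> \<le> ereal \<Lambda>"
  proof (rule mu_le_trial[OF test_X])
    fix c :: "nat \<Rightarrow> real" assume c: "\<exists>i\<le>k. c i \<noteq> 0"
    show "0 < (\<integral>x. \<rho> x * (\<Sum>i\<le>k. c i * X n i x)\<^sup>2 \<partial>lebesgue)" unfolding den by (rule pos(1)[OF c])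
    have D_eq: "c i * c j * D n i j = \<Lambda> * (c i * c j * A n i j) - ((1 + e n) ^ 3 * (c i * c j * B n i j) +
        ((e n)\<^sup>2 + e n) * K\<^sup>2 * (c i * c j * C n i j))" for i j
      by (simp add: D_def right_diff_distrib distrib_left mult_ac)
    have "(\<Sum>i\<le>k. \<Sum>j\<le>k. c i * c j * D n i j) = \<Lambda> * (\<Sum>i\<le>k. \<Sum>j\<le>k. c i * c j * A n i j) -
        ((1 + e n) ^ 3 * (\<Sum>i\<le>k. \<Sum>j\<le>k. c i * c j * B n i j) +
         ((e n)\<^sup>2 + e n) * K\<^sup>2 * (\<Sum>i\<le>k. \<Sum>j\<le>k. c i * c j * C n i j))"
      unfolding D_eq by (simp only: sum_subtractf sum.distrib sum_distrib_left)
    then show "(\<integral>x. \<rho> x * (deriv (\<lambda>x. \<Sum>i\<le>k. c i * X n i x) x)\<^sup>2 \<partial>lebesgue) \<le>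
        \<Lambda> * (\<integral>x. \<rho> x * (\<Sum>i\<le>k. c i * X n i x)\<^sup>2 \<partial>lebesgue)"
      unfolding den using num[of c] pos(2)[OF c] by linarith
  qed
  then show ?thesis by (simp add: \<Lambda>_def \<omega>_def m_def)
qed

lemma mu_le: "mu k \<rho> \<le> ereal ((pi * real k / integral\<^sup>L lebesgue \<rho>)\<^sup>2)"
proof (rule ereal_le_epsilon2)
  fix \<epsilon> :: real assume "0 < \<epsilon>"
  then show "mu k \<rho> \<le> ereal ((pi * real k / integral\<^sup>L lebesgue \<rho>)\<^sup>2) + ereal \<epsilon>"
    using mu_le_aux by simp
qed

end

section \<open>Lower bound\<close>

lemma test_functions_bounded:
  assumes u: "u \<in> test_functions"
  shows "\<exists>M. \<forall>x. \<bar>u x\<bar> \<le> M"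
proof -
  let ?K = "closure {x. u x \<noteq> 0}"
  have "compact (u ` ?K)"
    using u by (intro compact_continuous_image smooth_continuous_on) (auto simp: test_functions_iff)
  then have "bounded (u ` ?K)" by (rule compact_imp_bounded)
  then obtain M where M: "\<And>x. x \<in> ?K \<Longrightarrow> \<bar>u x\<bar> \<le> M"
    unfolding bounded_iff by (metis imageI real_norm_def)
  have "\<bar>u x\<bar> \<le> max M 0" for x
  proof (cases "u x = 0")
    case False
    then have "x \<in> ?K" by (intro subsetD[OF closure_subset]) simp
    from M[OF this] show ?thesis by simp
  qed simp
  then show ?thesis by blast
qed

lemma integral_density_square_pos:
  assumes \<rho>: "\<rho> \<in> densities" and u: "u \<in> test_functions" and nz: "restr \<rho> u \<noteq> 0"
  shows "0 < (\<integral>x. \<rho> x * (u x)\<^sup>2 \<partial>lebesgue)"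
proof -
  obtain M where M: "\<And>x. \<bar>u x\<bar> \<le> M" using test_functions_bounded[OF u] by blast
  have int: "integrable lebesgue (\<lambda>x. \<rho> x * (u x)\<^sup>2)"
  proof (rule integrable_density_bounded[OF \<rho>])
    show "(\<lambda>x. (u x)\<^sup>2) \<in> borel_measurable lebesgue"
      by (intro smooth_measurable smooth_power test_functions_smooth u)
    show "\<bar>(u x)\<^sup>2\<bar> \<le> M\<^sup>2" for x
      using power_mono[OF M[of x] abs_ge_zero, of 2] by simp
  qed
  have nonneg: "0 \<le> \<rho> x * (u x)\<^sup>2" for x using density_nonneg[OF \<rho>] by simp
  have "0 \<le> (\<integral>x. \<rho> x * (u x)\<^sup>2 \<partial>lebesgue)" using nonneg by (intro integral_nonneg_AE AE_I2)
  moreover have "(\<integral>x. \<rho> x * (u x)\<^sup>2 \<partial>lebesgue) \<noteq> 0"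
    using nz integral_nonneg_eq_0_iff_AE[OF int] nonneg
    unfolding restr_eq_zero_iff[OF density_nonneg[OF \<rho>]] by simp
  ultimately show ?thesis by simp
qed

text \<open>One half of the min-max principle: at most k linear conditions have a common nonzero
  solution in dimension k + 1. The means are those of representatives \<open>w b\<close> fixed for a
  basis, so they need not be determined by the class.\<close>

lemma mu_ge_zero_means:
  fixes p q :: "'i \<Rightarrow> real"
  assumes \<rho>: "\<rho> \<in> densities" and I: "finite I" "card I \<le> k"
    and le: "\<And>u. u \<in> test_functions \<Longrightarrow> (\<And>i. i \<in> I \<Longrightarrow> integral {p i..q i} u = 0) \<Longrightarrow>
      \<Lambda> * (\<integral>x. \<rho> x * (u x)\<^sup>2 \<partial>lebesgue) \<le> (\<integral>x. \<rho> x * (deriv u x)\<^sup>2 \<partial>lebesgue)"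
  shows "ereal \<Lambda> \<le> mu k \<rho>"
  unfolding mu_def
proof (rule INF_greatest)
  fix S assume "S \<in> trial_subspaces (k + 1) \<rho>"
  then have S: "subspace S" "S \<subseteq> trial_space \<rho>" "dim S = k + 1" by (auto simp: trial_subspaces_def)
  obtain B where B: "B \<subseteq> S" "independent B" "S \<subseteq> span B" "card B = dim S"
    using basis_exists[of S] by blast
  \<comment> \<open>An infinite set has \<open>card\<close> 0, which is not k + 1.\<close>
  have finB: "finite B" using B(4) S(3) card.infinite by fastforce
  have "\<forall>b\<in>B. \<exists>w. w \<in> test_functions \<and> b = restr \<rho> w"
    using B(1) S(2) unfolding trial_space_def by blast
  then obtain w where w: "\<And>b. b \<in> B \<Longrightarrow> w b \<in> test_functions" "\<And>b. b \<in> B \<Longrightarrow> b = restr \<rho> (w b)"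
    by metis
  obtain c where c: "\<exists>b\<in>B. c b \<noteq> 0" "\<forall>i\<in>I. (\<Sum>b\<in>B. c b * integral {p i..q i} (w b)) = 0"
    using underdetermined_system[OF I(1) finB, of "\<lambda>i b. integral {p i..q i} (w b)"] I(2) B(4) S(3) by auto
  define u where "u x = (\<Sum>b\<in>B. c b * w b x)" for x
  have u: "u \<in> test_functions"
    unfolding u_def[abs_def] by (rule test_functions_sum[OF w(1)])
  have restr_u: "restr \<rho> u = (\<Sum>b\<in>B. c b *\<^sub>R b)"
    unfolding u_def[abs_def] restr_sum using w(2) by simp
  have nz: "restr \<rho> u \<noteq> 0"
    unfolding restr_u using c(1) independentD[OF B(2) finB subset_refl] by blast
  have "restr \<rho> u \<in> S"
    unfolding restr_u using B(1) by (intro subspace_sum[OF S(1)] subspace_scale[OF S(1)]) auto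
  moreover have "\<Lambda> \<le> rayleigh \<rho> u"
  proof -
    have "integral {p i..q i} u = 0" if "i \<in> I" for i
    proof -
      have "integral {p i..q i} u = (\<Sum>b\<in>B. integral {p i..q i} (\<lambda>x. c b * w b x))"
        unfolding u_def[abs_def]
      proof (rule Henstock_Kurzweil_Integration.integral_sum[OF finB])
        fix b assume "b \<in> B"
        then show "(\<lambda>x. c b * w b x) integrable_on {p i..q i}"
          by (intro integrable_continuous_real continuous_on_mult continuous_on_const
              smooth_continuous_on test_functions_smooth w(1))
      qed
      then show ?thesis using c(2) that by simp
    qed
    then have "\<Lambda> * (\<integral>x. \<rho> x * (u x)\<^sup>2 \<partial>lebesgue) \<le> (\<integral>x. \<rho> x * (deriv u x)\<^sup>2 \<partial>lebesgue)"
      by (intro le u) auto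
    then show ?thesis
      unfolding rayleigh_def using integral_density_square_pos[OF \<rho> u nz] by (simp add: pos_le_divide_eq)
  qed
  ultimately show "ereal \<Lambda> \<le> (SUP u\<in>{u \<in> test_functions. restr \<rho> u \<in> S - {0}}. ereal (rayleigh \<rho> u))"
    using u nz by (intro SUP_upper2[of u]) auto
qed

text \<open>Pieces of equal length share the constant (pi / h)^2, so their inequalities add up. This
  is what lengths that are multiples of m / k provide.\<close>

lemma wirtinger_inequality_pieces:
  fixes u :: "real \<Rightarrow> real"
  assumes u: "smooth u" and h: "0 < h"
    and mean: "\<And>l. l < j \<Longrightarrow> integral {a + real l * h..a + real (Suc l) * h} u = 0"
  shows "(pi / h)\<^sup>2 * integral {a..a + real j * h} (\<lambda>x. (u x)\<^sup>2) \<le>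
    integral {a..a + real j * h} (\<lambda>x. (deriv u x)\<^sup>2)"
  using mean
proof (induction j)
  case (Suc j)
  let ?c = "a + real j * h" and ?d = "a + real (Suc j) * h"
  have le: "a \<le> ?c" "?c < ?d" and len: "?d - ?c = h" using h by (auto simp: algebra_simps)
  have split: "integral {a..?d} f = integral {a..?c} f + integral {?c..?d} f"
    if "continuous_on UNIV f" for f :: "real \<Rightarrow> real"
    using le continuous_on_subset[OF that]
    by (intro Henstock_Kurzweil_Integration.integral_combine[symmetric] integrable_continuous_real) auto
  have cont: "continuous_on A (\<lambda>x. (u x)\<^sup>2)" "continuous_on A (\<lambda>x. (deriv u x)\<^sup>2)" for A
    by (intro continuous_on_power smooth_continuous_on smooth_deriv u)+
  have "(pi / (?d - ?c))\<^sup>2 * integral {?c..?d} (\<lambda>x. (u x)\<^sup>2) \<le> integral {?c..?d} (\<lambda>x. (deriv u x)\<^sup>2)"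
    by (rule wirtinger_inequality[OF le(2) smooth_DERIV[OF u] smooth_continuous_on[OF smooth_deriv[OF u]]])
       (rule Suc.prems, simp)
  moreover have "(pi / h)\<^sup>2 * integral {a..?c} (\<lambda>x. (u x)\<^sup>2) \<le> integral {a..?c} (\<lambda>x. (deriv u x)\<^sup>2)"
    by (rule Suc.IH) (rule Suc.prems, simp)
  ultimately show ?case
    unfolding split[OF cont(1)] split[OF cont(2)] len by (simp add: distrib_left)
qed simp

text \<open>Passes from Lebesgue integrals over the open set to gauge integrals over closed
  intervals, where the Wirtinger inequality is stated; end points do not count.\<close>

lemma
  fixes a b :: "nat \<Rightarrow> real" and f :: "real \<Rightarrow> real"
  assumes ab: "\<And>i. i < N \<Longrightarrow> a i < b i" and disj: "disjoint_family_on (\<lambda>i. {a i<..<b i}) {..<N}"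
    and f: "continuous_on UNIV f"
  shows integrable_indicator_intervals:
      "integrable lebesgue (\<lambda>x. indicator (\<Union>i<N. {a i<..<b i}) x * f x)"
    and integral_indicator_intervals:
      "(\<integral>x. indicator (\<Union>i<N. {a i<..<b i}) x * f x \<partial>lebesgue) = (\<Sum>i<N. integral {a i..b i} f)"
proof -
  have eq: "indicator (\<Union>i<N. {a i<..<b i}) x * f x = (\<Sum>i<N. indicator {a i<..<b i} x *\<^sub>R f x)" for x
    by (simp add: indicator_UN_disjoint[OF finite_lessThan disj] sum_distrib_right)
  have int: "set_integrable lebesgue {a i<..<b i} f" for i
    by (rule set_integrable_subset[OF absolutely_integrable_continuous_real[of "a i" "b i", OF
            continuous_on_subset[OF f]]]) auto
  then have int': "integrable lebesgue (\<lambda>x. indicator {a i<..<b i} x *\<^sub>R f x)" for i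
    by (simp add: set_integrable_def)
  show "integrable lebesgue (\<lambda>x. indicator (\<Union>i<N. {a i<..<b i}) x * f x)"
    unfolding eq by (rule Bochner_Integration.integrable_sum[OF int'])
  have "(\<integral>x. indicator {a i<..<b i} x *\<^sub>R f x \<partial>lebesgue) = integral {a i..b i} f" for i
    using set_lebesgue_integral_eq_integral(2)[OF int]
    by (simp add: set_lebesgue_integral_def integral_open_interval_real)
  then show "(\<integral>x. indicator (\<Union>i<N. {a i<..<b i}) x * f x \<partial>lebesgue) = (\<Sum>i<N. integral {a i..b i} f)"
    unfolding eq Bochner_Integration.integral_sum[OF int'] by simp
qed

lemma
  fixes a b :: "nat \<Rightarrow> real"
  assumes ab: "\<And>i. i < N \<Longrightarrow> a i < b i" and disj: "disjoint_family_on (\<lambda>i. {a i<..<b i}) {..<N}"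
    and \<rho>: "\<rho> = indicator (\<Union>i<N. {a i<..<b i})" and m: "m = (\<Sum>i<N. b i - a i)" "0 < m"
  shows indicator_intervals_mass: "integral\<^sup>L lebesgue \<rho> = m"
    and indicator_intervals_density: "\<rho> \<in> densities"
proof -
  let ?A = "\<Union>i<N. {a i<..<b i}"
  have one: "continuous_on UNIV (\<lambda>_ :: real. 1 :: real)" by (rule continuous_on_const)
  have \<rho>_one: "\<rho> = (\<lambda>x. indicator ?A x * 1)" unfolding \<rho> by simp
  have "integral\<^sup>L lebesgue \<rho> = (\<Sum>i<N. integral {a i..b i} (\<lambda>_. 1 :: real))"
    unfolding \<rho>_one by (rule integral_indicator_intervals[OF ab disj one])
  also have "\<dots> = m"
    unfolding m(1) by (rule sum.cong) (use ab in \<open>auto simp: less_imp_le\<close>)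
  finally show mass: "integral\<^sup>L lebesgue \<rho> = m" .
  have int: "integrable lebesgue \<rho>"
    unfolding \<rho>_one by (rule integrable_indicator_intervals[OF ab disj one])
  have bounds: "0 \<le> \<rho> x \<and> \<rho> x \<le> 1" for x
    unfolding \<rho> by (simp add: indicator_le_1)
  show "\<rho> \<in> densities"
    unfolding densities_def mem_Collect_eq mass
    using borel_measurable_integrable[OF int] int bounds m(2) by blast
qed

lemma mu_ge_indicator_intervals:
  fixes a b :: "nat \<Rightarrow> real"
  assumes k: "1 \<le> k" and ab: "\<And>i. i < N \<Longrightarrow> a i < b i"
    and disj: "disjoint_family_on (\<lambda>i. {a i<..<b i}) {..<N}"
    and \<rho>: "\<rho> = indicator (\<Union>i<N. {a i<..<b i})" and m: "m = (\<Sum>i<N. b i - a i)" "0 < m"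
    and mult: "\<And>i. i < N \<Longrightarrow> \<exists>j :: int. b i - a i = of_int j * (m / real k)"
  shows "ereal ((pi * real k / m)\<^sup>2) \<le> mu k \<rho>"
proof -
  define h where "h = m / real k"
  have h: "0 < h" using k m by (simp add: h_def)
  have "\<exists>j :: nat. b i = a i + real j * h" if i: "i < N" for i
  proof -
    obtain j :: int where j: "b i - a i = of_int j * h" using mult[OF i] by (auto simp: h_def)
    then have "0 < of_int j * h" using ab[OF i] by simp
    then have "0 < j" using h by (simp add: zero_less_mult_iff)
    \<comment> \<open>Positive length forces a positive multiple, so the integer can be read as a
      number of pieces.\<close>
    then show ?thesis using j by (intro exI[of _ "nat j"]) simp
  qed
  then obtain J :: "nat \<Rightarrow> nat" where J: "\<And>i. i < N \<Longrightarrow> b i = a i + real (J i) * h" by metis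
  have "real k * h = m" using k by (simp add: h_def)
  also have "\<dots> = (\<Sum>i<N. real (J i) * h)"
    unfolding m(1) by (rule sum.cong) (auto simp: J)
  also have "\<dots> = real (\<Sum>i<N. J i) * h" by (simp add: sum_distrib_right)
  \<comment> \<open>The total length m = k h yields exactly k pieces, hence k mean conditions
    against dimension k + 1.\<close>
  finally have card: "(\<Sum>i<N. J i) = k" using h by (simp del: of_nat_sum)
  define I where "I = (SIGMA i:{..<N}. {..<J i})"
  define p where "p = (\<lambda>(i, l). a i + real l * h)"
  define q where "q = (\<lambda>(i, l). a i + real (Suc l) * h)"
  have "ereal ((pi / h)\<^sup>2) \<le> mu k \<rho>"
  proof (rule mu_ge_zero_means)
    show "\<rho> \<in> densities" by (rule indicator_intervals_density[OF ab disj \<rho> m])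
    show "finite I" "card I \<le> k" by (simp_all add: I_def card)
  next
    fix u assume u: "u \<in> test_functions" and mean: "\<And>i. i \<in> I \<Longrightarrow> integral {p i..q i} u = 0"
    note smooth = test_functions_smooth[OF u]
    have cont: "continuous_on UNIV (\<lambda>x. (u x)\<^sup>2)" "continuous_on UNIV (\<lambda>x. (deriv u x)\<^sup>2)"
      by (intro continuous_on_power smooth_continuous_on smooth_deriv smooth)+
    have "(pi / h)\<^sup>2 * integral {a i..b i} (\<lambda>x. (u x)\<^sup>2) \<le> integral {a i..b i} (\<lambda>x. (deriv u x)\<^sup>2)"
      if i: "i < N" for i
      unfolding J[OF i]
    proof (rule wirtinger_inequality_pieces[OF smooth h])
      fix l assume "l < J i"
      then show "integral {a i + real l * h..a i + real (Suc l) * h} u = 0"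
        using mean[of "(i, l)"] i by (simp add: I_def p_def q_def del: of_nat_Suc)
    qed
    then have "(pi / h)\<^sup>2 * (\<Sum>i<N. integral {a i..b i} (\<lambda>x. (u x)\<^sup>2)) \<le>
        (\<Sum>i<N. integral {a i..b i} (\<lambda>x. (deriv u x)\<^sup>2))"
      unfolding sum_distrib_left by (intro sum_mono) simp
    moreover have "(\<integral>x. \<rho> x * (u x)\<^sup>2 \<partial>lebesgue) = (\<Sum>i<N. integral {a i..b i} (\<lambda>x. (u x)\<^sup>2))"
      unfolding \<rho> by (rule integral_indicator_intervals[OF ab disj cont(1)])
    moreover have "(\<integral>x. \<rho> x * (deriv u x)\<^sup>2 \<partial>lebesgue) =
        (\<Sum>i<N. integral {a i..b i} (\<lambda>x. (deriv u x)\<^sup>2))"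
      unfolding \<rho> by (rule integral_indicator_intervals[OF ab disj cont(2)])
    ultimately show "(pi / h)\<^sup>2 * (\<integral>x. \<rho> x * (u x)\<^sup>2 \<partial>lebesgue) \<le> (\<integral>x. \<rho> x * (deriv u x)\<^sup>2 \<partial>lebesgue)"
      by simp
  qed
  then show ?thesis by (simp add: h_def)
qed

section \<open>The supremum\<close>

theorem theorem2:
  fixes k :: nat
  assumes "1 \<le> k"
  shows "(SUP \<rho>\<in>densities. ereal ((integral\<^sup>L lebesgue \<rho>)\<^sup>2) * mu k \<rho>) = ereal (pi\<^sup>2 * (real k)\<^sup>2) \<and>
    (\<forall>(\<rho> :: real \<Rightarrow> real) (N :: nat) (a :: nat \<Rightarrow> real) (b :: nat \<Rightarrow> real) (m :: real).
       N \<le> k \<and> (\<forall>i<N. a i < b i) \<and>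
       disjoint_family_on (\<lambda>i. {a i<..<b i}) {..<N} \<and>
       \<rho> = indicator (\<Union>i<N. {a i<..<b i}) \<and>
       m = (\<Sum>i<N. b i - a i) \<and> 0 < m \<and>
       (\<forall>i<N. \<exists>j :: int. b i - a i = of_int j * (m / real k)) \<longrightarrow>
       \<rho> \<in> densities \<and>
       ereal ((integral\<^sup>L lebesgue \<rho>)\<^sup>2) * mu k \<rho> = ereal (pi\<^sup>2 * (real k)\<^sup>2))"
proof -
  have le: "ereal ((integral\<^sup>L lebesgue \<rho>)\<^sup>2) * mu k \<rho> \<le> ereal (pi\<^sup>2 * (real k)\<^sup>2)"
    if \<rho>: "\<rho> \<in> densities" for \<rho>
  proof -
    let ?m = "integral\<^sup>L lebesgue \<rho>"
    have "ereal (?m\<^sup>2) * mu k \<rho> \<le> ereal (?m\<^sup>2) * ereal ((pi * real k / ?m)\<^sup>2)"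
      by (rule ereal_mult_left_mono[OF mu_le[OF \<rho>]]) simp
    also have "\<dots> = ereal (pi\<^sup>2 * (real k)\<^sup>2)"
      using density_mass_pos[OF \<rho>] by (simp add: power_divide power_mult_distrib)
    finally show ?thesis .
  qed
  have eq: "\<rho> \<in> densities \<and> ereal ((integral\<^sup>L lebesgue \<rho>)\<^sup>2) * mu k \<rho> = ereal (pi\<^sup>2 * (real k)\<^sup>2)"
    if ab: "\<And>i. i < N \<Longrightarrow> a i < b i" and disj: "disjoint_family_on (\<lambda>i. {a i<..<b i}) {..<N}"
      and \<rho>: "\<rho> = indicator (\<Union>i<N. {a i<..<b i})" and m: "m = (\<Sum>i<N. b i - a i)" "0 < m"
      and mult: "\<And>i. i < N \<Longrightarrow> \<exists>j :: int. b i - a i = of_int j * (m / real k)"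
    for \<rho> N and a b :: "nat \<Rightarrow> real" and m
  proof -
    have dens: "\<rho> \<in> densities" and mass: "integral\<^sup>L lebesgue \<rho> = m"
      using indicator_intervals_density[OF ab disj \<rho> m] indicator_intervals_mass[OF ab disj \<rho> m] by simp_all
    have "mu k \<rho> = ereal ((pi * real k / m)\<^sup>2)"
      using mu_le[OF dens, of k] mu_ge_indicator_intervals[OF assms ab disj \<rho> m mult]
      unfolding mass by (rule antisym)
    then show ?thesis
      using dens m(2) by (simp add: mass power_divide power_mult_distrib)
  qed
  \<comment> \<open>A single unit interval has length k times 1 / k, so it is extremal for every k
    and the supremum is reached.\<close>
  define \<rho>1 :: "real \<Rightarrow> real" where "\<rho>1 = indicator (\<Union>i<1::nat. {0<..<1})"
  have \<rho>1: "\<rho>1 \<in> densities \<and> ereal ((integral\<^sup>L lebesgue \<rho>1)\<^sup>2) * mu k \<rho>1 = ereal (pi\<^sup>2 * (real k)\<^sup>2)"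
  proof (rule eq[where N = 1 and a = "\<lambda>_. 0" and b = "\<lambda>_. 1" and m = 1])
    show "\<rho>1 = indicator (\<Union>i<1::nat. {0<..<1})" by (rule \<rho>1_def)
    show "\<exists>j :: int. 1 - 0 = of_int j * (1 / real k)"
      using assms by (intro exI[of _ "int k"]) simp
  qed (auto simp: disjoint_family_on_def)
  have "(SUP \<rho>\<in>densities. ereal ((integral\<^sup>L lebesgue \<rho>)\<^sup>2) * mu k \<rho>) = ereal (pi\<^sup>2 * (real k)\<^sup>2)"
  proof (rule antisym)
    show "(SUP \<rho>\<in>densities. ereal ((integral\<^sup>L lebesgue \<rho>)\<^sup>2) * mu k \<rho>) \<le> ereal (pi\<^sup>2 * (real k)\<^sup>2)"
      by (rule SUP_least) (rule le)
    show "ereal (pi\<^sup>2 * (real k)\<^sup>2) \<le> (SUP \<rho>\<in>densities. ereal ((integral\<^sup>L lebesgue \<rho>)\<^sup>2) * mu k \<rho>)"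
      by (rule SUP_upper2[of \<rho>1]) (use \<rho>1 in auto)
  qed
  then show ?thesis using eq by blast
qed

end
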